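(* Let $M_0>0$ and $M>M_0$. There exists $r=r(M_0,M)>0$ such that for each $(\varphi,\tau_0)\in\mathrm{Lip}_\alpha\times C_+(\Omega)$ with $\|\varphi\|_{\mathrm{Lip}_\alpha}+\|\tau_0\|_\infty\le M_0$, system (1.1) admits a unique solution $(A,\tau)\in C((-\infty,r],C(\Omega))\times C([0,r],C(\Omega))$ on $[0,r]$, and moreover $\|A(t,\cdot)\|_\infty\le M$ for all $t\in[0,r]$.
   Context: $\Omega\subset\mathbb R^n$ compact, $C(\Omega)$ with sup norm, $C_+(\Omega)$ nonnegative functions, $\alpha\ge0$ fixed. Standing assumption: $F:C(\Omega)\times C(\Omega)\times C(\Omega^2)\to C(\Omega)$ is Lipschitz on bounded sets (for every $M>0$ there is $L(M)$ with $\|F(u,v,w)-F(\hat u,\hat v,\hat w)\|_\infty\le L(M)[\|u-\hat u\|_\infty+\|v-\hat v\|_\infty+\|w-\hat w\|_\infty]$ when all arguments have norm $\le M$); $f:C(\Omega)\to C(\Omega)$ is Lipschitz, $0<f(\phi)(x)\le M_f$ for a constant $M_f$, and non-increasing for the pointwise order. $\mathrm{Lip}_\alpha$: $\phi\in C((-\infty,0],C(\Omega))$ with $\theta\mapsto e^{-\alpha|\theta|}\phi(\theta)$ bounded and Lipschitz, norm = sup norm + Lipschitz seminorm of that map. A solution of (1.1) on $[0,r]$ with initial distribution $(\varphi,\tau_0)$: continuous $A:(-\infty,r]\to C(\Omega)$, $\tau:[0,r]\to C_+(\Omega)$ with $A=\varphi$ on $(-\infty,0]$, $A(t,x)=\varphi(0,x)+\int_0^tF(A(l,\cdot),\tau(l,\cdot),A(l-\tau(l)))(x)dl$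 for $t\in[0,r]$, where $A(l-\tau(l))\in C(\Omega^2)$ is $(x,y)\mapsto A(l-\tau(l,x),y)$, and $\int_{t-\tau(t,x)}^tf(A(s,\cdot))(x)ds=\int_{-\tau_0(x)}^0f(\varphi(s,\cdot))(x)ds$ for $t\in[0,r]$, $x\in\Omega$. *)

theory Defs
  imports "HOL-Analysis.Analysis"
begin

(* Sup norm on a set S (C(S) with sup norm); the 0 makes it well-behaved for S empty. *)
definition supn :: "'b set \<Rightarrow> ('b \<Rightarrow> real) \<Rightarrow> real" where
  "supn S g = Sup (insert 0 ((\<lambda>x. \<bar>g x\<bar>) ` S))"

definition cont_into_C :: "('a::euclidean_space) set \<Rightarrow> real set \<Rightarrow> (real \<Rightarrow> 'a \<Rightarrow> real) \<Rightarrow> bool" where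
  "cont_into_C \<Omega> I A \<longleftrightarrow>
     (\<forall>t\<in>I. continuous_on \<Omega> (A t)) \<and>
     (\<forall>t\<in>I. \<forall>e>0. \<exists>d>0. \<forall>s\<in>I. \<bar>s - t\<bar> < d \<longrightarrow> supn \<Omega> (\<lambda>x. A s x - A t x) < e)"

definition F_assm :: "('a::euclidean_space) set \<Rightarrow> (('a \<Rightarrow> real) \<Rightarrow> ('a \<Rightarrow> real) \<Rightarrow> ('a \<times> 'a \<Rightarrow> real) \<Rightarrow> ('a \<Rightarrow> real)) \<Rightarrow> bool" where
  "F_assm \<Omega> F \<longleftrightarrow>
     (\<forall>u v w. continuous_on \<Omega> u \<and> continuous_on \<Omega> v \<and> continuous_on (\<Omega> \<times> \<Omega>) w
        \<longrightarrow> continuous_on \<Omega> (F u v w)) \<and>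
     (\<forall>M>0. \<exists>L. \<forall>u v w u' v' w'.
        continuous_on \<Omega> u \<and> continuous_on \<Omega> v \<and> continuous_on (\<Omega> \<times> \<Omega>) w \<and>
        continuous_on \<Omega> u' \<and> continuous_on \<Omega> v' \<and> continuous_on (\<Omega> \<times> \<Omega>) w' \<and>
        supn \<Omega> u \<le> M \<and> supn \<Omega> v \<le> M \<and> supn (\<Omega> \<times> \<Omega>) w \<le> M \<and>
        supn \<Omega> u' \<le> M \<and> supn \<Omega> v' \<le> M \<and> supn (\<Omega> \<times> \<Omega>) w' \<le> M
        \<longrightarrow> supn \<Omega> (\<lambda>x. F u v w x - F u' v' w' x)
              \<le> L * (supn \<Omega> (\<lambda>x. u x - u' x) + supn \<Omega> (\<lambda>x. v x - v' x)
                     + supn (\<Omega> \<times> \<Omega>) (\<lambda>p. w p - w' p)))"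

definition f_assm :: "('a::euclidean_space) set \<Rightarrow> (('a \<Rightarrow> real) \<Rightarrow> ('a \<Rightarrow> real)) \<Rightarrow> real \<Rightarrow> bool" where
  "f_assm \<Omega> f Mf \<longleftrightarrow>
     (\<forall>u. continuous_on \<Omega> u \<longrightarrow> continuous_on \<Omega> (f u)) \<and>
     (\<exists>L. \<forall>u v. continuous_on \<Omega> u \<and> continuous_on \<Omega> v \<longrightarrow>
         supn \<Omega> (\<lambda>x. f u x - f v x) \<le> L * supn \<Omega> (\<lambda>x. u x - v x)) \<and>
     (\<forall>u. continuous_on \<Omega> u \<longrightarrow> (\<forall>x\<in>\<Omega>. 0 < f u x \<and> f u x \<le> Mf)) \<and>
     (\<forall>u v. continuous_on \<Omega> u \<and> continuous_on \<Omega> v \<and> (\<forall>x\<in>\<Omega>. u x \<le> v x)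
        \<longrightarrow> (\<forall>x\<in>\<Omega>. f v x \<le> f u x))"

definition wgt :: "real \<Rightarrow> (real \<Rightarrow> 'a \<Rightarrow> real) \<Rightarrow> real \<Rightarrow> 'a \<Rightarrow> real" where
  "wgt \<alpha> \<phi> \<theta> x = exp (- \<alpha> * \<bar>\<theta>\<bar>) * \<phi> \<theta> x"

definition in_Lip_alpha :: "('a::euclidean_space) set \<Rightarrow> real \<Rightarrow> (real \<Rightarrow> 'a \<Rightarrow> real) \<Rightarrow> bool" where
  "in_Lip_alpha \<Omega> \<alpha> \<phi> \<longleftrightarrow>
     cont_into_C \<Omega> {..0} \<phi> \<and>
     bdd_above ((\<lambda>\<theta>. supn \<Omega> (wgt \<alpha> \<phi> \<theta>)) ` {..0}) \<and>
     (\<exists>L. \<forall>\<theta>\<le>0. \<forall>\<theta>'\<le>0.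
        supn \<Omega> (\<lambda>x. wgt \<alpha> \<phi> \<theta> x - wgt \<alpha> \<phi> \<theta>' x) \<le> L * \<bar>\<theta> - \<theta>'\<bar>)"

definition Lip_alpha_norm :: "('a::euclidean_space) set \<Rightarrow> real \<Rightarrow> (real \<Rightarrow> 'a \<Rightarrow> real) \<Rightarrow> real" where
  "Lip_alpha_norm \<Omega> \<alpha> \<phi> =
     Sup ((\<lambda>\<theta>. supn \<Omega> (wgt \<alpha> \<phi> \<theta>)) ` {..0})
     + Sup {supn \<Omega> (\<lambda>x. wgt \<alpha> \<phi> \<theta> x - wgt \<alpha> \<phi> \<theta>' x) / \<bar>\<theta> - \<theta>'\<bar> | \<theta> \<theta>'.
              \<theta> \<le> 0 \<and> \<theta>' \<le> 0 \<and> \<theta> \<noteq> \<theta>'}"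

definition is_solution ::
  "('a::euclidean_space) set \<Rightarrow> (('a \<Rightarrow> real) \<Rightarrow> ('a \<Rightarrow> real) \<Rightarrow> ('a \<times> 'a \<Rightarrow> real) \<Rightarrow> ('a \<Rightarrow> real))
   \<Rightarrow> (('a \<Rightarrow> real) \<Rightarrow> ('a \<Rightarrow> real)) \<Rightarrow> (real \<Rightarrow> 'a \<Rightarrow> real) \<Rightarrow> ('a \<Rightarrow> real) \<Rightarrow> real
   \<Rightarrow> (real \<Rightarrow> 'a \<Rightarrow> real) \<Rightarrow> (real \<Rightarrow> 'a \<Rightarrow> real) \<Rightarrow> bool" where
  "is_solution \<Omega> F f \<phi> \<tau>0 r A \<tau> \<longleftrightarrow>
     cont_into_C \<Omega> {..r} A \<and>
     cont_into_C \<Omega> {0..r} \<tau> \<and>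
     (\<forall>t\<in>{0..r}. \<forall>x\<in>\<Omega>. 0 \<le> \<tau> t x) \<and>
     (\<forall>t\<le>0. \<forall>x\<in>\<Omega>. A t x = \<phi> t x) \<and>
     (\<forall>t\<in>{0..r}. \<forall>x\<in>\<Omega>.
        A t x = \<phi> 0 x + integral {0..t} (\<lambda>l. F (A l) (\<tau> l) (\<lambda>(y, z). A (l - \<tau> l y) z) x)) \<and>
     (\<forall>t\<in>{0..r}. \<forall>x\<in>\<Omega>.
        integral {t - \<tau> t x..t} (\<lambda>s. f (A s) x) = integral {- \<tau>0 x..0} (\<lambda>s. f (\<phi> s) x))"

end

theory Submission
  imports Defs
begin

text \<open>The threshold condition determines \<open>\<tau>\<close> from \<open>A\<close>: since \<open>f > 0\<close>, the delayed time
  \<open>t - \<tau>(t,x)\<close> is the unique \<open>\<sigma> \<ge> -\<tau>\<^sub>0(x)\<close> with the prescribed value of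
  \<open>\<integral>\<^sub>\<sigma>\<^sup>t f(A(s))(x) ds\<close>. On bounded sets \<open>f\<close> is bounded below by some \<open>\<gamma> > 0\<close>, so the delay depends
  Lipschitz continuously on \<open>A\<close>; for \<open>A\<close> Lipschitz in time, so does \<open>A(l - \<tau>(l))\<close>. The integral
  equation for \<open>A\<close> alone is then solved by Picard iteration, on functions bounded by \<open>M\<close> with a fixed
  Lipschitz constant; \<open>r\<close> depends only on the constants for a ball in \<open>C(\<Omega>)\<close> containing all
  relevant values. Every solution is automatically Lipschitz in time on the relevant interval, which
  gives uniqueness without assuming the bound \<open>M\<close>.\<close>

text \<open>The norm of the history is weighted, so for \<alpha> > 0 a history may grow
  exponentially into the past and admits no uniform bound on the half line. What lets
  \<open>r\<close> depend on \<open>M0\<close> and \<open>M\<close> alone is the reach of the delay: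
  positivity of \<open>f\<close> and the threshold condition force \<open>t - \<tau> t x\<close> to
  stay above \<open>- \<tau>0 x\<close>, hence above \<open>-M0\<close>. Only the window from
  \<open>-M0\<close> to \<open>r\<close> matters, and on it removing the weight costs at most the
  factor \<open>exp (\<alpha> * M0)\<close>. The obstacle to a contraction on all continuous
  functions is that evaluating A at a perturbed time is not Lipschitz in the sup norm: an error in
  the delay becomes an error in the value only through the modulus of continuity of A. Hence the
  Lipschitz constant in time is built into the space of iterates. Uniqueness has to compete with
  solutions whose bounds may exceed those used to choose \<open>r\<close>, so the existence
  contraction cannot serve there; an iterated estimate that needs no smallness of \<open>r\<close>
  takes its place.\<close>

section \<open>Sup norm, and continuity into C(\<Omega>) as joint continuity\<close>

lemma abs_le_supn:
  fixes g :: "'b::topological_space \<Rightarrow> real"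
  assumes "compact S" "continuous_on S g" "x \<in> S"
  shows "\<bar>g x\<bar> \<le> supn S g"
proof -
  have "compact ((\<lambda>x. \<bar>g x\<bar>) ` S)"
    by (intro compact_continuous_image continuous_intros assms)
  then have "bdd_above ((\<lambda>x. \<bar>g x\<bar>) ` S)"
    by (simp add: bounded_imp_bdd_above compact_imp_bounded)
  then show ?thesis
    unfolding supn_def using assms(3) by (intro cSup_upper) auto
qed

lemma supn_nonneg:
  fixes g :: "'b::topological_space \<Rightarrow> real"
  assumes "compact S" "continuous_on S g"
  shows "0 \<le> supn S g"
proof (cases "S = {}")
  case True
  then show ?thesis by (simp add: supn_def)
next
  case False
  then obtain x where "x \<in> S" by blast
  then show ?thesis using abs_le_supn[OF assms, of x] by simp
qed

lemma supn_least:
  assumes "0 \<le> c" "\<And>x. x \<in> S \<Longrightarrow> \<bar>g x\<bar> \<le> c"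
  shows "supn S g \<le> c"
  unfolding supn_def using assms by (intro cSup_least) auto

lemma continuous_on_slice:
  assumes "continuous_on (I \<times> S) (\<lambda>(t, x). A t x)" "t \<in> I"
  shows "continuous_on S (A t)"
proof -
  have "continuous_on S ((\<lambda>(t, x). A t x) \<circ> (\<lambda>x. (t, x)))"
    using assms by (intro continuous_on_compose continuous_intros)
      (auto intro: continuous_on_subset)
  then show ?thesis by (simp add: o_def)
qed

lemma continuous_on_slice_fst:
  assumes "continuous_on (I \<times> S) (\<lambda>(t, x). A t x)" "x \<in> S"
  shows "continuous_on I (\<lambda>t. A t x)"
proof -
  have "continuous_on I ((\<lambda>(t, x). A t x) \<circ> (\<lambda>t. (t, x)))"
    using assms by (intro continuous_on_compose continuous_intros)
      (auto intro: continuous_on_subset)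
  then show ?thesis by (simp add: o_def)
qed

text \<open>Composition arguments want a function of the pair (t, x), not a curve of functions.
  Forwards, the error splits into a uniform change in t and the continuity of one slice; backwards,
  compactness of \<Omega> makes the time neighbourhood independent of x (tube lemma).\<close>

lemma cont_into_C_iff:
  fixes \<Omega> :: "'a::euclidean_space set"
  assumes "compact \<Omega>"
  shows "cont_into_C \<Omega> I A \<longleftrightarrow> continuous_on (I \<times> \<Omega>) (\<lambda>(t, x). A t x)"
proof
  assume *: "cont_into_C \<Omega> I A"
  then have slice: "\<And>t. t \<in> I \<Longrightarrow> continuous_on \<Omega> (A t)"
    by (simp add: cont_into_C_def)
  show "continuous_on (I \<times> \<Omega>) (\<lambda>(t, x). A t x)"
    unfolding continuous_on_iff
  proof (intro ballI allI impI)
    fix q and e :: real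
    assume "q \<in> I \<times> \<Omega>" and e: "0 < e"
    then obtain t x where q: "q = (t, x)" and t: "t \<in> I" and x: "x \<in> \<Omega>" by auto
    obtain d1 where d1: "d1 > 0"
      "\<And>s. s \<in> I \<Longrightarrow> \<bar>s - t\<bar> < d1 \<Longrightarrow> supn \<Omega> (\<lambda>x. A s x - A t x) < e / 2"
      using * t e unfolding cont_into_C_def by (meson half_gt_zero)
    obtain d2 where d2: "d2 > 0"
      "\<And>y. y \<in> \<Omega> \<Longrightarrow> dist y x < d2 \<Longrightarrow> dist (A t y) (A t x) < e / 2"
      using slice[OF t] x e unfolding continuous_on_iff by (meson half_gt_zero)
    show "\<exists>d>0. \<forall>p\<in>I \<times> \<Omega>. dist p q < d \<longrightarrow>
        dist (case p of (t, x) \<Rightarrow> A t x) (case q of (t, x) \<Rightarrow> A t x) < e"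
    proof (intro exI[of _ "min d1 d2"] conjI ballI impI, goal_cases)
      case 1
      then show ?case using d1 d2 by simp
    next
      case (2 p)
      obtain s y where p: "p = (s, y)" by fastforce
      have sy: "s \<in> I" "y \<in> \<Omega>" using 2 p by auto
      have "dist s t < d1" "dist y x < d2"
        using 2 p q dist_fst_le[of p "(t, x)"] dist_snd_le[of p "(t, x)"] by auto
      then have "supn \<Omega> (\<lambda>x. A s x - A t x) < e / 2" "dist (A t y) (A t x) < e / 2"
        using d1(2)[OF sy(1)] d2(2)[OF sy(2)] by (auto simp: dist_real_def)
      moreover have "\<bar>A s y - A t y\<bar> \<le> supn \<Omega> (\<lambda>x. A s x - A t x)"
        by (rule abs_le_supn[OF assms _ sy(2), where g = "\<lambda>x. A s x - A t x"])
          (intro continuous_intros slice sy t)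
      ultimately show ?case unfolding p q prod.case dist_real_def by (smt (verit) field_sum_of_halves)
    qed
  qed
next
  assume *: "continuous_on (I \<times> \<Omega>) (\<lambda>(t, x). A t x)"
  show "cont_into_C \<Omega> I A"
    unfolding cont_into_C_def
  proof (intro conjI ballI allI impI)
    fix t assume t: "t \<in> I"
    show "continuous_on \<Omega> (A t)" by (rule continuous_on_slice[OF * t])
    fix e :: real assume e: "e > 0"
    \<comment> \<open>Passing to the supremum loses strictness, hence \<open>e / 2\<close>.\<close>
    obtain X0 where X0: "t \<in> X0" "open X0"
      "\<forall>s\<in>X0 \<inter> I. \<forall>x\<in>\<Omega>. dist (case (s, x) of (t, x) \<Rightarrow> A t x) (case (t, x) of (t, x) \<Rightarrow> A t x) \<le> e / 2"
      using continuous_on_prod_compactE[OF * assms t, of "e / 2"] e by (metis half_gt_zero)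
    obtain d where d: "d > 0" "ball t d \<subseteq> X0"
      using X0 by (meson openE)
    show "\<exists>d>0. \<forall>s\<in>I. \<bar>s - t\<bar> < d \<longrightarrow> supn \<Omega> (\<lambda>x. A s x - A t x) < e"
    proof (intro exI[of _ d] conjI ballI impI)
      fix s assume s: "s \<in> I" "\<bar>s - t\<bar> < d"
      then have "s \<in> X0 \<inter> I" using d by (auto simp: dist_real_def subset_iff)
      then have "supn \<Omega> (\<lambda>x. A s x - A t x) \<le> e / 2"
        using X0(3) e by (intro supn_least) (auto simp: dist_real_def)
      then show "supn \<Omega> (\<lambda>x. A s x - A t x) < e" using e by simp
    qed (use d in simp)
  qed
qed

text \<open>A Lipschitz bound in t that is uniform in x leaves only the slices to check; integrals
  with variable upper limit are treated this way.\<close>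

lemma continuous_on_Times_Lipschitz:
  fixes A :: "real \<Rightarrow> 'a::metric_space \<Rightarrow> real"
  assumes lip: "\<And>s t x. s \<in> I \<Longrightarrow> t \<in> I \<Longrightarrow> x \<in> S \<Longrightarrow> \<bar>A s x - A t x\<bar> \<le> K * \<bar>s - t\<bar>"
    and slice: "\<And>t. t \<in> I \<Longrightarrow> continuous_on S (A t)"
  shows "continuous_on (I \<times> S) (\<lambda>(t, x). A t x)"
  unfolding continuous_on_iff
proof (intro ballI allI impI)
  fix q and e :: real
  assume "q \<in> I \<times> S" and e: "0 < e"
  then obtain t x where q: "q = (t, x)" and t: "t \<in> I" and x: "x \<in> S" by auto
  \<comment> \<open>No sign is assumed for \<open>K\<close>; the added 1 keeps the denominator
    positive when \<open>K = 0\<close>.\<close>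
  define d1 where "d1 = e / (2 * (\<bar>K\<bar> + 1))"
  have d1: "d1 > 0" using e by (simp add: d1_def)
  have d1': "\<bar>K\<bar> * d1 \<le> e / 2"
    using e by (simp add: d1_def field_simps)
  obtain d2 where d2: "d2 > 0"
    "\<And>y. y \<in> S \<Longrightarrow> dist y x < d2 \<Longrightarrow> dist (A t y) (A t x) < e / 2"
    using slice[OF t] x e unfolding continuous_on_iff by (meson half_gt_zero)
  show "\<exists>d>0. \<forall>p\<in>I \<times> S. dist p q < d \<longrightarrow>
      dist (case p of (t, x) \<Rightarrow> A t x) (case q of (t, x) \<Rightarrow> A t x) < e"
  proof (intro exI[of _ "min d1 d2"] conjI ballI impI, goal_cases)
    case 1
    then show ?case using d1 d2 by simp
  next
    case (2 p)
    obtain s y where p: "p = (s, y)" by fastforce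
    have sy: "s \<in> I" "y \<in> S" using 2 p by auto
    have st: "dist s t < d1" and "dist y x < d2"
      using 2 p q dist_fst_le[of p "(t, x)"] dist_snd_le[of p "(t, x)"] by auto
    then have "dist (A t y) (A t x) < e / 2"
      using d2(2)[OF sy(2)] by auto
    moreover have "\<bar>A s y - A t y\<bar> \<le> \<bar>K\<bar> * \<bar>s - t\<bar>"
      using lip[OF sy(1) t sy(2)] by (smt (verit) mult_right_mono)
    moreover have "\<bar>K\<bar> * \<bar>s - t\<bar> \<le> \<bar>K\<bar> * d1"
      using st by (intro mult_left_mono) (auto simp: dist_real_def)
    ultimately show ?case using d1' unfolding p q prod.case dist_real_def by (smt (verit) field_sum_of_halves)
  qed
qed

lemma abs_bounded_on_compact:
  fixes g :: "'b::topological_space \<Rightarrow> real"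
  assumes "compact S" "continuous_on S g"
  obtains B where "0 < B" "\<And>x. x \<in> S \<Longrightarrow> \<bar>g x\<bar> \<le> B"
proof
  show "0 < supn S g + 1" using supn_nonneg[OF assms] by simp
  show "\<And>x. x \<in> S \<Longrightarrow> \<bar>g x\<bar> \<le> supn S g + 1" using abs_le_supn[OF assms] by fastforce
qed

section \<open>Banach iteration on a set of real functions\<close>

text \<open>Banach's fixed point theorem with factor 1/2, where arbitrary pointwise bounds on
  \<open>S\<close> stand for the sup distance. Functions are total and their values off
  \<open>S\<close> uncontrolled, so convergence, closedness and the fixed point equation all refer
  to \<open>S\<close> only.\<close>

lemma uniform_fixed_point:
  fixes T :: "('b \<Rightarrow> real) \<Rightarrow> ('b \<Rightarrow> real)"
  assumes u0: "u0 \<in> X"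
    and TX: "\<And>u. u \<in> X \<Longrightarrow> T u \<in> X"
    and D: "0 \<le> D" "\<And>p. p \<in> S \<Longrightarrow> \<bar>T u0 p - u0 p\<bar> \<le> D"
    and contr: "\<And>u v d p. u \<in> X \<Longrightarrow> v \<in> X \<Longrightarrow> 0 \<le> d \<Longrightarrow> (\<And>p. p \<in> S \<Longrightarrow> \<bar>u p - v p\<bar> \<le> d) \<Longrightarrow>
            p \<in> S \<Longrightarrow> \<bar>T u p - T v p\<bar> \<le> d / 2"
    and closed: "\<And>u g. (\<And>n::nat. g n \<in> X) \<Longrightarrow> uniform_limit S g u sequentially \<Longrightarrow> u \<in> X"
  shows "\<exists>u\<in>X. \<forall>p\<in>S. T u p = u p"
proof -
  define g where "g n = (T ^^ n) u0" for n
  have gX: "g n \<in> X" for n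
    by (induction n) (auto simp: g_def u0 TX)
  have gS: "g (Suc n) = T (g n)" for n by (simp add: g_def)
  have step: "\<bar>g (Suc n) p - g n p\<bar> \<le> D * (1/2) ^ n" if "p \<in> S" for n p
    using that
  proof (induction n arbitrary: p)
    case 0
    then show ?case using D by (simp add: g_def)
  next
    case (Suc n)
    have "\<bar>T (g (Suc n)) p - T (g n) p\<bar> \<le> D * (1/2) ^ n / 2"
      by (rule contr) (use Suc gX D in auto)
    then show ?case by (simp add: gS)
  qed
  \<comment> \<open>The iterates are telescoping sums of geometrically small steps, so the
    Weierstrass test applies.\<close>
  have "uniformly_convergent_on S (\<lambda>n p. \<Sum>i<n. g (Suc i) p - g i p)"
    by (rule Weierstrass_m_test'[where M = "\<lambda>n. D * (1/2) ^ n"])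
      (use step in \<open>auto intro!: summable_mult summable_geometric\<close>)
  moreover have "(\<Sum>i<n. g (Suc i) p - g i p) = g n p - g 0 p" for n p
    by (induction n) auto
  ultimately have "uniformly_convergent_on S (\<lambda>n p. g n p - g 0 p)"
    by simp
  then obtain l where l: "uniform_limit S (\<lambda>n p. g n p - g 0 p) l sequentially"
    by (auto simp: uniformly_convergent_on_def)
  define u where "u = (\<lambda>p. l p + g 0 p)"
  have lim: "uniform_limit S g u sequentially"
    using uniform_limit_add[OF l uniform_limit_const[where S = S and c = "g 0"]] by (simp add: u_def)
  have uX: "u \<in> X" by (rule closed[OF gX lim])
  have "T u p = u p" if p: "p \<in> S" for p
  proof -
    have "\<bar>T u p - u p\<bar> \<le> e" if e: "e > 0" for e
    proof -
      have "\<forall>\<^sub>F n in sequentially. \<forall>p\<in>S. dist (g n p) (u p) < e / 2"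
        using lim e unfolding uniform_limit_iff by (meson half_gt_zero)
      then obtain N where N: "\<And>n p. n \<ge> N \<Longrightarrow> p \<in> S \<Longrightarrow> \<bar>g n p - u p\<bar> < e / 2"
        by (auto simp: eventually_sequentially dist_real_def)
      have "\<bar>T (g N) p - T u p\<bar> \<le> e / 2 / 2"
        by (rule contr[OF gX uX _ _ p]) (use N[of N] e in \<open>auto intro: less_imp_le\<close>)
      moreover have "\<bar>T (g N) p - u p\<bar> < e / 2"
        using N[of "Suc N", OF _ p] by (simp add: gS)
      ultimately show ?thesis using e by (simp add: abs_if split: if_splits)
    qed
    then show ?thesis
      using field_le_epsilon[of "\<bar>T u p - u p\<bar>" 0] by simp
  qed
  then show ?thesis using uX by blast
qed

section \<open>Integral thresholds and the delays they define\<close>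

text \<open>The lower bound \<gamma> turns a gap between the lower limits into a gap between
  integrals of \<open>h1\<close>, and equality of the thresholds turns that into an integral of
  \<open>h1 - h2\<close>. This difference vanishes before time 0, so the factor is \<open>t\<close>,
  small for short times, and not the window length \<open>t + m\<close>.\<close>

lemma threshold_compare:
  fixes h1 h2 :: "real \<Rightarrow> real"
  assumes cont: "continuous_on {-m..t} h1" "continuous_on {-m..t} h2"
    and lower: "\<And>s. s \<in> {-m..t} \<Longrightarrow> \<gamma> \<le> h1 s"
    and past: "\<And>s. s \<in> {-m..0} \<Longrightarrow> h1 s = h2 s"
    and close: "\<And>s. s \<in> {0..t} \<Longrightarrow> \<bar>h1 s - h2 s\<bar> \<le> \<delta>"
    and \<sigma>: "\<sigma>1 \<in> {-m..t}" "\<sigma>2 \<in> {-m..t}" and "0 \<le> t" "0 \<le> \<delta>"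
    and eq: "integral {\<sigma>1..t} h1 = integral {\<sigma>2..t} h2"
  shows "\<gamma> * \<bar>\<sigma>1 - \<sigma>2\<bar> \<le> t * \<delta>"
proof -
  have int: "h1 integrable_on {a..b}" "h2 integrable_on {a..b}" if "-m \<le> a" "b \<le> t" for a b
    by (intro integrable_continuous_interval continuous_on_subset[OF cont(1)]
        continuous_on_subset[OF cont(2)]; use that in auto)+
  have low: "\<gamma> * (b - a) \<le> integral {a..b} h1" if "-m \<le> a" "a \<le> b" "b \<le> t" for a b
  proof -
    have "integral {a..b} (\<lambda>_. \<gamma>) \<le> integral {a..b} h1"
      using that by (intro integral_le int lower) auto
    then show ?thesis using that by (simp add: mult.commute)
  qed
  have "\<gamma> * \<bar>\<sigma>1 - \<sigma>2\<bar> \<le> \<bar>integral {\<sigma>2..t} h1 - integral {\<sigma>1..t} h1\<bar>"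
  proof (cases "\<sigma>1 \<le> \<sigma>2")
    case True
    then show ?thesis
      using Henstock_Kurzweil_Integration.integral_combine[of \<sigma>1 \<sigma>2 t h1] int(1)[of \<sigma>1 t] low[of \<sigma>1 \<sigma>2] \<sigma> by auto
  next
    case False
    then show ?thesis
      using Henstock_Kurzweil_Integration.integral_combine[of \<sigma>2 \<sigma>1 t h1] int(1)[of \<sigma>2 t] low[of \<sigma>2 \<sigma>1] \<sigma> by auto
  qed
  \<comment> \<open>By \<open>eq\<close>, the subtracted integral of \<open>h1\<close> equals that
    of \<open>h2\<close> from \<sigma>2, so both now run over the same interval.\<close>
  also have "\<dots> = \<bar>integral {\<sigma>2..t} (\<lambda>s. h1 s - h2 s)\<bar>"
    using eq int[of \<sigma>2 t] \<sigma> by (simp add: integral_diff)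
  also have "\<dots> \<le> t * \<delta>"
  proof -
    have bound: "\<bar>integral {a..t} (\<lambda>s. h1 s - h2 s)\<bar> \<le> \<delta> * (t - a)" if "0 \<le> a" "a \<le> t" "-m \<le> a" for a
    proof -
      have "norm (integral {a..t} (\<lambda>s. h1 s - h2 s)) \<le> \<delta> * (t - a)"
        using that close
        by (intro integral_bound continuous_intros continuous_on_subset[OF cont(1)]
            continuous_on_subset[OF cont(2)]) auto
      then show ?thesis by simp
    qed
    show ?thesis
    proof (cases "0 \<le> \<sigma>2")
      case True
      then have "\<delta> * (t - \<sigma>2) \<le> \<delta> * t" using \<open>0 \<le> \<delta>\<close> by (intro mult_left_mono) auto
      then show ?thesis using bound[of \<sigma>2] True \<sigma> by (simp add: mult.commute)
    next
      case False
      have "integral {\<sigma>2..0} (\<lambda>s. h1 s - h2 s) = integral {\<sigma>2..0} (\<lambda>_. 0)"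
        using past \<sigma> by (intro integral_cong) auto
      moreover have "integral {\<sigma>2..0} (\<lambda>s. h1 s - h2 s) + integral {0..t} (\<lambda>s. h1 s - h2 s)
          = integral {\<sigma>2..t} (\<lambda>s. h1 s - h2 s)"
        using False \<sigma> \<open>0 \<le> t\<close> by (intro Henstock_Kurzweil_Integration.integral_combine integrable_diff int) auto
      ultimately show ?thesis
        using bound[of 0] False \<sigma> \<open>0 \<le> t\<close> by (simp add: mult.commute)
    qed
  qed
  finally show ?thesis .
qed

lemma integral_Lipschitz:
  fixes g :: "real \<Rightarrow> real"
  assumes cont: "continuous_on {c..r} g" and bound: "\<And>s. s \<in> {c..r} \<Longrightarrow> \<bar>g s\<bar> \<le> B"
    and "a \<in> {c..r}" "b \<in> {c..r}"
  shows "\<bar>integral {c..a} g - integral {c..b} g\<bar> \<le> B * \<bar>a - b\<bar>"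
proof -
  have *: "\<bar>integral {c..b} g - integral {c..a} g\<bar> \<le> B * (b - a)" if "c \<le> a" "a \<le> b" "b \<le> r" for a b
  proof -
    have "integral {c..a} g + integral {a..b} g = integral {c..b} g"
      using that by (intro Henstock_Kurzweil_Integration.integral_combine
          integrable_continuous_interval continuous_on_subset[OF cont]) auto
    moreover have "norm (integral {a..b} g) \<le> B * (b - a)"
      using that by (intro integral_bound continuous_on_subset[OF cont]) (auto intro: bound)
    ultimately show ?thesis by simp
  qed
  show ?thesis
    using *[of a b] *[of b a] assms(3,4) by (cases "a \<le> b") (auto simp: abs_minus_commute)
qed

lemma integral_continuous_Times:
  fixes g :: "real \<Rightarrow> 'a::metric_space \<Rightarrow> real"
  assumes "compact \<Omega>" and cont: "continuous_on ({c..r} \<times> \<Omega>) (\<lambda>(s, x). g s x)"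
  shows "continuous_on ({c..r} \<times> \<Omega>) (\<lambda>(t, x). integral {c..t} (\<lambda>s. g s x))"
proof -
  have "compact ({c..r} \<times> \<Omega>)" using \<open>compact \<Omega>\<close> by (intro compact_Times) auto
  then obtain B where B: "0 < B" "\<And>p. p \<in> {c..r} \<times> \<Omega> \<Longrightarrow> \<bar>case p of (s, x) \<Rightarrow> g s x\<bar> \<le> B"
    using abs_bounded_on_compact[OF _ cont] by blast
  show ?thesis
  proof (rule continuous_on_Times_Lipschitz)
    fix s t x assume "s \<in> {c..r}" "t \<in> {c..r}" "x \<in> \<Omega>"
    then show "\<bar>integral {c..s} (\<lambda>s. g s x) - integral {c..t} (\<lambda>s. g s x)\<bar> \<le> B * \<bar>s - t\<bar>"
      using B(2)[of "(_, x)"]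
      by (intro integral_Lipschitz[where r = r] continuous_on_slice_fst[OF cont]) auto
  next
    fix t assume t: "t \<in> {c..r}"
    have "continuous_on (\<Omega> \<times> cbox c t) (\<lambda>p. (\<lambda>(s, x). g s x) (snd p, fst p))"
      using t by (intro continuous_on_compose2[OF cont] continuous_intros) auto
    then have "continuous_on (\<Omega> \<times> cbox c t) (\<lambda>(x, s). g s x)"
      by (simp add: case_prod_unfold)
    then show "continuous_on \<Omega> (\<lambda>x. integral {c..t} (\<lambda>s. g s x))"
      using integral_continuous_on_param[of \<Omega> c t "\<lambda>x s. g s x"] by simp
  qed
qed

text \<open>Past and future bounds come from different sources, the history and the integral
  equation. Across 0 nothing is lost, since the distances to 0 add up to the distance between the
  points.\<close>

lemma Lipschitz_glue:
  fixes h :: "real \<Rightarrow> real"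
  assumes past: "\<And>s t. s \<in> {-m..0} \<Longrightarrow> t \<in> {-m..0} \<Longrightarrow> \<bar>h s - h t\<bar> \<le> K * \<bar>s - t\<bar>"
    and future: "\<And>s t. s \<in> {0..r} \<Longrightarrow> t \<in> {0..r} \<Longrightarrow> \<bar>h s - h t\<bar> \<le> K * \<bar>s - t\<bar>"
    and "s \<in> {-m..r}" "t \<in> {-m..r}"
  shows "\<bar>h s - h t\<bar> \<le> K * \<bar>s - t\<bar>"
proof -
  have mixed: "\<bar>h s - h t\<bar> \<le> K * \<bar>s - t\<bar>" if "-m \<le> s" "s \<le> 0" "0 \<le> t" "t \<le> r" for s t
  proof -
    have "\<bar>h s - h t\<bar> \<le> K * \<bar>s - 0\<bar> + K * \<bar>0 - t\<bar>"
      using past[of s 0] future[of 0 t] that by auto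
    also have "\<dots> = K * \<bar>s - t\<bar>" using that by (simp add: algebra_simps)
    finally show ?thesis .
  qed
  consider "s \<le> 0" "t \<le> 0" | "0 \<le> s" "0 \<le> t" | "s \<le> 0" "0 \<le> t" | "0 \<le> s" "t \<le> 0"
    by linarith
  then show ?thesis
  proof cases
    case 4
    then show ?thesis using mixed[of t s] assms(3,4) by (simp add: abs_minus_commute)
  qed (use past future mixed assms(3,4) in auto)
qed

text \<open>In terms of a primitive \<open>H\<close> in time, the delayed time \<sigma> solves
  \<open>H \<sigma> x = V t x\<close>. The intermediate value theorem gives a solution between
  \<open>- \<tau>0 x\<close> and \<open>t\<close>. It is picked separately for each pair, yet
  depends continuously on it because \<open>H\<close> grows at rate at least \<gamma>.\<close>

lemma threshold_exists:
  fixes g :: "real \<Rightarrow> 'a::metric_space \<Rightarrow> real"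
  assumes "compact \<Omega>" "0 \<le> r" "0 < \<gamma>"
    and cont: "continuous_on ({-m..r} \<times> \<Omega>) (\<lambda>(s, x). g s x)"
    and lower: "\<And>s x. s \<in> {-m..r} \<Longrightarrow> x \<in> \<Omega> \<Longrightarrow> \<gamma> \<le> g s x"
    and cont0: "continuous_on \<Omega> \<tau>0"
    and \<tau>0: "\<And>x. x \<in> \<Omega> \<Longrightarrow> 0 \<le> \<tau>0 x" "\<And>x. x \<in> \<Omega> \<Longrightarrow> \<tau>0 x \<le> m"
  obtains \<tau> where "continuous_on ({0..r} \<times> \<Omega>) (\<lambda>(t, x). \<tau> t x)"
    "\<And>t x. t \<in> {0..r} \<Longrightarrow> x \<in> \<Omega> \<Longrightarrow> 0 \<le> \<tau> t x"
    "\<And>t x. t \<in> {0..r} \<Longrightarrow> x \<in> \<Omega> \<Longrightarrow>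
       integral {t - \<tau> t x..t} (\<lambda>s. g s x) = integral {- \<tau>0 x..0} (\<lambda>s. g s x)"
proof -
  define H where "H s x = integral {-m..s} (\<lambda>s. g s x)" for s x
  have slice: "continuous_on {a..b} (\<lambda>s. g s x)" if "x \<in> \<Omega>" "-m \<le> a" "b \<le> r" for a b x
    by (rule continuous_on_subset[OF continuous_on_slice_fst[OF cont]]) (use that in auto)
  have int: "(\<lambda>s. g s x) integrable_on {a..b}" if "x \<in> \<Omega>" "-m \<le> a" "b \<le> r" for a b x
    by (intro integrable_continuous_interval slice that)
  have H: "integral {a..b} (\<lambda>s. g s x) = H b x - H a x"
    if "x \<in> \<Omega>" "-m \<le> a" "a \<le> b" "b \<le> r" for a b x
    using Henstock_Kurzweil_Integration.integral_combine[of "-m" a b "\<lambda>s. g s x"] int that by (simp add: H_def)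
  have low: "\<gamma> * (b - a) \<le> H b x - H a x" if "x \<in> \<Omega>" "-m \<le> a" "a \<le> b" "b \<le> r" for a b x
  proof -
    have "integral {a..b} (\<lambda>_. \<gamma>) \<le> integral {a..b} (\<lambda>s. g s x)"
      using that by (intro integral_le int lower) auto
    then show ?thesis using that H by (simp add: mult.commute)
  qed
  have mono: "H a x \<le> H b x" if "x \<in> \<Omega>" "-m \<le> a" "a \<le> b" "b \<le> r" for a b x
    using low[OF that] that \<open>0 < \<gamma>\<close> by (smt (verit) mult_nonneg_nonneg)
  have Hcont: "continuous_on ({-m..r} \<times> \<Omega>) (\<lambda>(s, x). H s x)"
    unfolding H_def by (rule integral_continuous_Times[OF \<open>compact \<Omega>\<close> cont])
  have Hcomp: "continuous_on U (\<lambda>p. H (a p) (b p))"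
    if "continuous_on U a" "continuous_on U b" "\<And>p. p \<in> U \<Longrightarrow> a p \<in> {-m..r} \<and> b p \<in> \<Omega>"
    for U and a :: "real \<times> 'a \<Rightarrow> real" and b :: "real \<times> 'a \<Rightarrow> 'a"
  proof -
    have "continuous_on U (\<lambda>p. (\<lambda>(s, x). H s x) (a p, b p))"
      by (intro continuous_on_compose2[OF Hcont] continuous_on_Pair that) (use that(3) in auto)
    then show ?thesis by simp
  qed
  \<comment> \<open>The condition \<open>H t x - H \<sigma> x = H 0 x - H (- \<tau>0 x) x\<close>,
    solved for \<open>H \<sigma> x\<close>.\<close>
  define V where "V t x = H t x - H 0 x + H (- \<tau>0 x) x" for t x
  have "\<forall>t\<in>{0..r}. \<forall>x\<in>\<Omega>. \<exists>\<sigma>. - \<tau>0 x \<le> \<sigma> \<and> \<sigma> \<le> t \<and> H \<sigma> x = V t x"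
  proof (intro ballI)
    fix t x assume t: "t \<in> {0..r}" and x: "x \<in> \<Omega>"
    have "continuous_on {- \<tau>0 x..t} (\<lambda>s. H s x)"
      by (rule continuous_on_subset[OF continuous_on_slice_fst[OF Hcont x]]) (use t \<tau>0[OF x] in auto)
    moreover have "H (- \<tau>0 x) x \<le> V t x" "V t x \<le> H t x"
      using mono[OF x, of 0 t] mono[OF x, of "- \<tau>0 x" 0] t \<tau>0[OF x] by (auto simp: V_def)
    ultimately show "\<exists>\<sigma>. - \<tau>0 x \<le> \<sigma> \<and> \<sigma> \<le> t \<and> H \<sigma> x = V t x"
      using IVT'[of "\<lambda>s. H s x" "- \<tau>0 x" "V t x" t] t \<tau>0[OF x] by force
  qed
  then obtain \<sigma> where \<sigma>: "\<And>t x. t \<in> {0..r} \<Longrightarrow> x \<in> \<Omega> \<Longrightarrow> - \<tau>0 x \<le> \<sigma> t x \<and> \<sigma> t x \<le> t \<and> H (\<sigma> t x) x = V t x"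
    by metis
  have \<sigma>m: "\<sigma> t x \<in> {-m..r}" if "t \<in> {0..r}" "x \<in> \<Omega>" for t x
    using \<sigma>[OF that] \<tau>0[OF that(2)] that by auto
  have \<sigma>cont: "continuous_on ({0..r} \<times> \<Omega>) (\<lambda>(t, x). \<sigma> t x)"
    unfolding continuous_on_iff
  proof (intro ballI allI impI)
    fix q and e :: real
    assume q: "q \<in> {0..r} \<times> \<Omega>" and e: "0 < e"
    define \<sigma>q where "\<sigma>q = \<sigma> (fst q) (snd q)"
    have \<sigma>q: "\<sigma>q \<in> {-m..r}" using q \<sigma>m by (auto simp: \<sigma>q_def)
    \<comment> \<open>Freezing \<open>\<sigma>q\<close> gives a function that vanishes at
      \<open>q\<close> and equals \<open>H \<sigma>p x - H \<sigma>q x\<close>, with the same x, at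
      a nearby \<open>p\<close>. The growth bound \<open>low\<close> then inverts \<open>H\<close>
      in time only.\<close>
    have Vcont: "continuous_on ({0..r} \<times> \<Omega>) (\<lambda>p. V (fst p) (snd p) - H \<sigma>q (snd p))"
    proof -
      have "0 \<le> m" if "x \<in> \<Omega>" for x
        using \<tau>0[OF that] by linarith
      note m = this
      have c0: "continuous_on ({0..r} \<times> \<Omega>) (\<lambda>p. - \<tau>0 (snd p))"
        by (intro continuous_on_minus continuous_on_compose2[OF cont0] continuous_on_snd
            continuous_on_id) auto
      have "continuous_on ({0..r} \<times> \<Omega>) (\<lambda>p. H (fst p) (snd p))"
        "continuous_on ({0..r} \<times> \<Omega>) (\<lambda>p. H 0 (snd p))"
        "continuous_on ({0..r} \<times> \<Omega>) (\<lambda>p. H \<sigma>q (snd p))"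
        by (rule Hcomp; use m \<sigma>q \<open>0 \<le> r\<close> in
            \<open>auto intro!: continuous_on_fst continuous_on_snd intro: order_trans[of _ 0]\<close>)+
      moreover have "continuous_on ({0..r} \<times> \<Omega>) (\<lambda>p. H (- \<tau>0 (snd p)) (snd p))"
        by (rule Hcomp[OF c0]) (use \<tau>0 m \<open>0 \<le> r\<close> in
            \<open>auto intro!: continuous_on_snd intro: order_trans[of _ 0]\<close>)
      ultimately show ?thesis
        unfolding V_def by (intro continuous_on_diff continuous_on_add)
    qed
    obtain d where d: "d > 0" "\<And>p. p \<in> {0..r} \<times> \<Omega> \<Longrightarrow> dist p q < d \<Longrightarrow>
        dist (V (fst p) (snd p) - H \<sigma>q (snd p)) (V (fst q) (snd q) - H \<sigma>q (snd q)) < \<gamma> * e"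
      using Vcont[unfolded continuous_on_iff, rule_format, OF q mult_pos_pos[OF \<open>0 < \<gamma>\<close> e]]
      by auto
    show "\<exists>d>0. \<forall>p\<in>{0..r} \<times> \<Omega>. dist p q < d \<longrightarrow>
        dist (case p of (t, x) \<Rightarrow> \<sigma> t x) (case q of (t, x) \<Rightarrow> \<sigma> t x) < e"
    proof (intro exI[of _ d] conjI ballI impI d(1))
      fix p assume p: "p \<in> {0..r} \<times> \<Omega>" "dist p q < d"
      define \<sigma>p where "\<sigma>p = \<sigma> (fst p) (snd p)"
      have \<sigma>p: "\<sigma>p \<in> {-m..r}" using p \<sigma>m by (auto simp: \<sigma>p_def)
      have "H \<sigma>q (snd q) = V (fst q) (snd q)" "H \<sigma>p (snd p) = V (fst p) (snd p)"
        using \<sigma> p q by (auto simp: \<sigma>q_def \<sigma>p_def)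
      then have "\<bar>H \<sigma>p (snd p) - H \<sigma>q (snd p)\<bar> < \<gamma> * e"
        using d(2)[OF p] by (simp add: dist_real_def)
      moreover have "\<gamma> * \<bar>\<sigma>p - \<sigma>q\<bar> \<le> \<bar>H \<sigma>p (snd p) - H \<sigma>q (snd p)\<bar>"
        using low[of "snd p" \<sigma>p \<sigma>q] low[of "snd p" \<sigma>q \<sigma>p] \<sigma>p \<sigma>q p
        by (cases "\<sigma>p \<le> \<sigma>q") auto
      ultimately have "\<gamma> * \<bar>\<sigma>p - \<sigma>q\<bar> < \<gamma> * e" by linarith
      then show "dist (case p of (t, x) \<Rightarrow> \<sigma> t x) (case q of (t, x) \<Rightarrow> \<sigma> t x) < e"
        using \<open>0 < \<gamma>\<close> by (simp add: dist_real_def case_prod_unfold \<sigma>p_def \<sigma>q_def)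
    qed
  qed
  show thesis
  proof (rule that[of "\<lambda>t x. t - \<sigma> t x"])
    show "continuous_on ({0..r} \<times> \<Omega>) (\<lambda>(t, x). t - \<sigma> t x)"
      using \<sigma>cont unfolding case_prod_unfold by (intro continuous_intros)
    fix t x assume t: "t \<in> {0..r}" and x: "x \<in> \<Omega>"
    show "0 \<le> t - \<sigma> t x" using \<sigma>[OF t x] by simp
    have "integral {\<sigma> t x..t} (\<lambda>s. g s x) = H t x - H (\<sigma> t x) x"
      using \<sigma>[OF t x] \<sigma>m[OF t x] t x by (intro H) auto
    moreover have "integral {- \<tau>0 x..0} (\<lambda>s. g s x) = H 0 x - H (- \<tau>0 x) x"
      using \<tau>0[OF x] t x by (intro H) auto
    ultimately show "integral {t - (t - \<sigma> t x)..t} (\<lambda>s. g s x) = integral {- \<tau>0 x..0} (\<lambda>s. g s x)"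
      using \<sigma>[OF t x] by (simp add: V_def)
  qed
qed

section \<open>The assumptions in pointwise form and composition with F and f\<close>

definition C_ball :: "'b::topological_space set \<Rightarrow> real \<Rightarrow> ('b \<Rightarrow> real) set" where
  "C_ball S R = {g. continuous_on S g \<and> (\<forall>x\<in>S. \<bar>g x\<bar> \<le> R)}"

text \<open>Arbitrary pointwise bounds \<open>a\<close>, \<open>b\<close>, \<open>c\<close> replace
  the sup norms of the differences, and the local Lipschitz constant is a chosen nonnegative
  function \<open>LF\<close> of the radius. The passage from \<open>F_assm\<close> and
  \<open>f_assm\<close> is \<open>delay_system_exists\<close>.\<close>

locale delay_system =
  fixes \<Omega> :: "'a::euclidean_space set"
    and F :: "('a \<Rightarrow> real) \<Rightarrow> ('a \<Rightarrow> real) \<Rightarrow> ('a \<times> 'a \<Rightarrow> real) \<Rightarrow> ('a \<Rightarrow> real)"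
    and f :: "('a \<Rightarrow> real) \<Rightarrow> ('a \<Rightarrow> real)"
    and LF :: "real \<Rightarrow> real" and Lf :: real
  assumes compact: "compact \<Omega>"
    and F_cont: "\<And>u v w. continuous_on \<Omega> u \<Longrightarrow> continuous_on \<Omega> v \<Longrightarrow> continuous_on (\<Omega> \<times> \<Omega>) w \<Longrightarrow>
        continuous_on \<Omega> (F u v w)"
    and LF_nonneg: "\<And>R. 0 < R \<Longrightarrow> 0 \<le> LF R"
    and F_lip: "\<And>R u v w u' v' w' a b c x. 0 < R \<Longrightarrow>
        u \<in> C_ball \<Omega> R \<Longrightarrow> v \<in> C_ball \<Omega> R \<Longrightarrow> w \<in> C_ball (\<Omega> \<times> \<Omega>) R \<Longrightarrow>
        u' \<in> C_ball \<Omega> R \<Longrightarrow> v' \<in> C_ball \<Omega> R \<Longrightarrow> w' \<in> C_ball (\<Omega> \<times> \<Omega>) R \<Longrightarrow>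
        (\<And>y. y \<in> \<Omega> \<Longrightarrow> \<bar>u y - u' y\<bar> \<le> a) \<Longrightarrow> (\<And>y. y \<in> \<Omega> \<Longrightarrow> \<bar>v y - v' y\<bar> \<le> b) \<Longrightarrow>
        (\<And>y z. y \<in> \<Omega> \<Longrightarrow> z \<in> \<Omega> \<Longrightarrow> \<bar>w (y, z) - w' (y, z)\<bar> \<le> c) \<Longrightarrow> x \<in> \<Omega> \<Longrightarrow>
        \<bar>F u v w x - F u' v' w' x\<bar> \<le> LF R * (a + b + c)"
    and f_cont: "\<And>u. continuous_on \<Omega> u \<Longrightarrow> continuous_on \<Omega> (f u)"
    and Lf_nonneg: "0 \<le> Lf"
    and f_lip: "\<And>u v a x. continuous_on \<Omega> u \<Longrightarrow> continuous_on \<Omega> v \<Longrightarrow>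
        (\<And>y. y \<in> \<Omega> \<Longrightarrow> \<bar>u y - v y\<bar> \<le> a) \<Longrightarrow> x \<in> \<Omega> \<Longrightarrow> \<bar>f u x - f v x\<bar> \<le> Lf * a"
    and f_pos: "\<And>u x. continuous_on \<Omega> u \<Longrightarrow> x \<in> \<Omega> \<Longrightarrow> 0 < f u x"
    and f_antimono: "\<And>u v x. continuous_on \<Omega> u \<Longrightarrow> continuous_on \<Omega> v \<Longrightarrow>
        (\<And>y. y \<in> \<Omega> \<Longrightarrow> u y \<le> v y) \<Longrightarrow> x \<in> \<Omega> \<Longrightarrow> f v x \<le> f u x"
begin

text \<open>Within the ball each argument is at distance at most \<open>R\<close> from the zero
  function, so the Lipschitz bound controls \<open>F\<close> by its value at zero.\<close>

lemma F_bounded: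
  assumes "0 < R"
  obtains B where "0 \<le> B" "\<And>u v w x. u \<in> C_ball \<Omega> R \<Longrightarrow> v \<in> C_ball \<Omega> R \<Longrightarrow>
      w \<in> C_ball (\<Omega> \<times> \<Omega>) R \<Longrightarrow> x \<in> \<Omega> \<Longrightarrow> \<bar>F u v w x\<bar> \<le> B"
proof -
  obtain B0 where B0: "0 < B0"
    "\<And>x. x \<in> \<Omega> \<Longrightarrow> \<bar>F (\<lambda>_. 0) (\<lambda>_. 0) (\<lambda>_. 0) x\<bar> \<le> B0"
    using abs_bounded_on_compact[OF compact F_cont, of "\<lambda>_. 0" "\<lambda>_. 0" "\<lambda>_. 0"] by auto
  show thesis
  proof (rule that[of "B0 + LF R * (R + R + R)"])
    show "0 \<le> B0 + LF R * (R + R + R)" using B0 LF_nonneg assms by simp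
    fix u v w x
    assume *: "u \<in> C_ball \<Omega> R" "v \<in> C_ball \<Omega> R" "w \<in> C_ball (\<Omega> \<times> \<Omega>) R" "x \<in> \<Omega>"
    have "\<bar>F u v w x - F (\<lambda>_. 0) (\<lambda>_. 0) (\<lambda>_. 0) x\<bar> \<le> LF R * (R + R + R)"
      by (rule F_lip[OF assms]) (use * assms in \<open>auto simp: C_ball_def\<close>)
    then show "\<bar>F u v w x\<bar> \<le> B0 + LF R * (R + R + R)" using B0(2)[OF *(4)] by linarith
  qed
qed

text \<open>This is where the monotonicity of \<open>f\<close> enters: on the ball of radius \<open>R\<close> the function
  \<open>f\<close> is at least its value at the constant \<open>R\<close>.\<close>

lemma f_lower_bound:
  obtains \<gamma> where "0 < \<gamma>" "\<And>u x. u \<in> C_ball \<Omega> R \<Longrightarrow> x \<in> \<Omega> \<Longrightarrow> \<gamma> \<le> f u x"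
proof (cases "\<Omega> = {}")
  case True
  then show ?thesis using that[of 1] by simp
next
  case False
  obtain x0 where x0: "x0 \<in> \<Omega>" "\<And>x. x \<in> \<Omega> \<Longrightarrow> f (\<lambda>_. R) x0 \<le> f (\<lambda>_. R) x"
    using continuous_attains_inf[OF compact False f_cont[of "\<lambda>_. R"]] by auto
  show ?thesis
  proof (rule that[of "f (\<lambda>_. R) x0"])
    show "0 < f (\<lambda>_. R) x0" by (rule f_pos) (use x0 in auto)
    fix u x assume "u \<in> C_ball \<Omega> R" "x \<in> \<Omega>"
    then have "f (\<lambda>_. R) x \<le> f u x"
      by (intro f_antimono) (auto simp: C_ball_def abs_le_iff)
    then show "f (\<lambda>_. R) x0 \<le> f u x" using x0(2)[OF \<open>x \<in> \<Omega>\<close>] by simp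
  qed
qed

text \<open>Elements of C(\<Omega>) are total functions regarded on \<Omega> only. The Lipschitz
  estimate at distance 0 shows that \<open>f\<close> respects this identification.\<close>

lemma f_cong:
  assumes "continuous_on \<Omega> u" "\<And>y. y \<in> \<Omega> \<Longrightarrow> u y = v y" "x \<in> \<Omega>"
  shows "f u x = f v x"
proof -
  have "continuous_on \<Omega> v" using assms(1,2) continuous_on_cong by metis
  then show ?thesis using f_lip[of u v 0 x] assms by simp
qed

lemma f_comp_continuous:
  fixes A :: "real \<Rightarrow> 'a \<Rightarrow> real"
  assumes "continuous_on (I \<times> \<Omega>) (\<lambda>(t, x). A t x)"
  shows "continuous_on (I \<times> \<Omega>) (\<lambda>(t, x). f (A t) x)"
proof -
  have A: "cont_into_C \<Omega> I A" using assms cont_into_C_iff[OF compact] by blast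
  have slice: "continuous_on \<Omega> (A t)" if "t \<in> I" for t
    by (rule continuous_on_slice[OF assms that])
  have "cont_into_C \<Omega> I (\<lambda>t. f (A t))"
    unfolding cont_into_C_def
  proof (intro conjI ballI allI impI)
    fix t e assume t: "t \<in> I" and e: "(0::real) < e"
    \<comment> \<open>Dividing by \<open>Lf + 1\<close> covers \<open>Lf = 0\<close> and leaves room
      for a strict inequality.\<close>
    define e' where "e' = e / (Lf + 1)"
    have e': "0 < e'" using e Lf_nonneg by (simp add: e'_def)
    have "Lf * e' < (Lf + 1) * e'" using e' by (simp add: algebra_simps)
    also have "\<dots> = e" using Lf_nonneg by (simp add: e'_def)
    finally have "Lf * e' < e" .
    obtain d where d: "0 < d"
      "\<And>s. s \<in> I \<Longrightarrow> \<bar>s - t\<bar> < d \<Longrightarrow> supn \<Omega> (\<lambda>x. A s x - A t x) < e'"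
      using A t e' unfolding cont_into_C_def by meson
    have "supn \<Omega> (\<lambda>x. f (A s) x - f (A t) x) < e" if s: "s \<in> I" "\<bar>s - t\<bar> < d" for s
    proof -
      have "\<bar>A s y - A t y\<bar> \<le> e'" if "y \<in> \<Omega>" for y
        using abs_le_supn[OF compact continuous_on_diff[OF slice[OF s(1)] slice[OF t]] that]
          d(2)[OF s] by simp
      then have "supn \<Omega> (\<lambda>x. f (A s) x - f (A t) x) \<le> Lf * e'"
        using Lf_nonneg e' s t by (intro supn_least f_lip slice) auto
      then show ?thesis using \<open>Lf * e' < e\<close> by simp
    qed
    then show "\<exists>d>0. \<forall>s\<in>I. \<bar>s - t\<bar> < d \<longrightarrow> supn \<Omega> (\<lambda>x. f (A s) x - f (A t) x) < e"
      using d(1) by blast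
  qed (use slice f_cont in blast)
  then show ?thesis using cont_into_C_iff[OF compact] by blast
qed

text \<open>\<open>F\<close> is Lipschitz on bounded sets only, so one ball must contain the
  arguments at all times; compactness of \<open>I\<close> and \<Omega> supplies its radius.\<close>

lemma F_comp_continuous:
  fixes u v :: "real \<Rightarrow> 'a \<Rightarrow> real" and w :: "real \<Rightarrow> 'a \<times> 'a \<Rightarrow> real"
  assumes u: "continuous_on (I \<times> \<Omega>) (\<lambda>(t, x). u t x)"
    and v: "continuous_on (I \<times> \<Omega>) (\<lambda>(t, x). v t x)"
    and w: "continuous_on (I \<times> (\<Omega> \<times> \<Omega>)) (\<lambda>(t, p). w t p)"
    and "compact I"
  shows "continuous_on (I \<times> \<Omega>) (\<lambda>(t, x). F (u t) (v t) (w t) x)"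
proof -
  have compact2: "compact (\<Omega> \<times> \<Omega>)" using compact by (intro compact_Times)
  have C: "cont_into_C \<Omega> I u" "cont_into_C \<Omega> I v" "cont_into_C (\<Omega> \<times> \<Omega>) I w"
    using u v w cont_into_C_iff[OF compact] cont_into_C_iff[OF compact2] by blast+
  note slice = continuous_on_slice[OF u] continuous_on_slice[OF v] continuous_on_slice[OF w]
  obtain R1 where R1: "R1 > 0" "\<And>p. p \<in> I \<times> \<Omega> \<Longrightarrow> \<bar>case p of (t, x) \<Rightarrow> u t x\<bar> \<le> R1"
    using abs_bounded_on_compact[OF compact_Times[OF \<open>compact I\<close> compact] u] by blast
  obtain R2 where R2: "R2 > 0" "\<And>p. p \<in> I \<times> \<Omega> \<Longrightarrow> \<bar>case p of (t, x) \<Rightarrow> v t x\<bar> \<le> R2"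
    using abs_bounded_on_compact[OF compact_Times[OF \<open>compact I\<close> compact] v] by blast
  obtain R3 where R3: "R3 > 0" "\<And>p. p \<in> I \<times> (\<Omega> \<times> \<Omega>) \<Longrightarrow> \<bar>case p of (t, x) \<Rightarrow> w t x\<bar> \<le> R3"
    using abs_bounded_on_compact[OF compact_Times[OF \<open>compact I\<close> compact2] w] by blast
  define R where "R = R1 + R2 + R3"
  have R: "0 < R" using R1(1) R2(1) R3(1) by (simp add: R_def)
  have ball: "u t \<in> C_ball \<Omega> R" "v t \<in> C_ball \<Omega> R" "w t \<in> C_ball (\<Omega> \<times> \<Omega>) R" if "t \<in> I" for t
    using slice[OF that] that R1(2)[of "(t, _)"] R2(2)[of "(t, _)"] R3(2)[of "(t, _)"]
      R1(1) R2(1) R3(1)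
    unfolding C_ball_def R_def by fastforce+
  have "cont_into_C \<Omega> I (\<lambda>t. F (u t) (v t) (w t))"
    unfolding cont_into_C_def
  proof (intro conjI ballI allI impI)
    fix t e assume t: "t \<in> I" and e: "(0::real) < e"
    define c where "c = LF R + 1"
    have c: "0 < c" using LF_nonneg[OF R] by (simp add: c_def)
    define e' where "e' = e / (3 * c)"
    have e': "0 < e'" using e c by (simp add: e'_def)
    have "LF R * (e' + e' + e') < c * (3 * e')" using e' by (simp add: c_def algebra_simps)
    also have "\<dots> = e" using c by (simp add: e'_def)
    finally have less: "LF R * (e' + e' + e') < e" .
    obtain d1 where d1: "0 < d1"
      "\<And>s. s \<in> I \<Longrightarrow> \<bar>s - t\<bar> < d1 \<Longrightarrow> supn \<Omega> (\<lambda>x. u s x - u t x) < e'"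
      using C(1) t e' unfolding cont_into_C_def by meson
    obtain d2 where d2: "0 < d2"
      "\<And>s. s \<in> I \<Longrightarrow> \<bar>s - t\<bar> < d2 \<Longrightarrow> supn \<Omega> (\<lambda>x. v s x - v t x) < e'"
      using C(2) t e' unfolding cont_into_C_def by meson
    obtain d3 where d3: "0 < d3"
      "\<And>s. s \<in> I \<Longrightarrow> \<bar>s - t\<bar> < d3 \<Longrightarrow> supn (\<Omega> \<times> \<Omega>) (\<lambda>x. w s x - w t x) < e'"
      using C(3) t e' unfolding cont_into_C_def by meson
    have "supn \<Omega> (\<lambda>x. F (u s) (v s) (w s) x - F (u t) (v t) (w t) x) < e"
      if s: "s \<in> I" "\<bar>s - t\<bar> < min d1 (min d2 d3)" for s
    proof -
      have "\<bar>u s y - u t y\<bar> \<le> e'" if "y \<in> \<Omega>" for y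
        using abs_le_supn[OF compact continuous_on_diff[OF slice(1)[OF s(1)] slice(1)[OF t]] that]
          d1(2)[OF s(1)] s(2) by simp
      moreover have "\<bar>v s y - v t y\<bar> \<le> e'" if "y \<in> \<Omega>" for y
        using abs_le_supn[OF compact continuous_on_diff[OF slice(2)[OF s(1)] slice(2)[OF t]] that]
          d2(2)[OF s(1)] s(2) by simp
      moreover have "\<bar>w s (y, z) - w t (y, z)\<bar> \<le> e'" if "y \<in> \<Omega>" "z \<in> \<Omega>" for y z
        using abs_le_supn[OF compact2 continuous_on_diff[OF slice(3)[OF s(1)] slice(3)[OF t]],
            of "(y, z)"] that d3(2)[OF s(1)] s(2) by simp
      ultimately have "supn \<Omega> (\<lambda>x. F (u s) (v s) (w s) x - F (u t) (v t) (w t) x)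
          \<le> LF R * (e' + e' + e')"
        using LF_nonneg[OF R] e' ball[OF s(1)] ball[OF t]
        by (intro supn_least F_lip[OF R]) auto
      then show ?thesis using less by simp
    qed
    then show "\<exists>d>0. \<forall>s\<in>I. \<bar>s - t\<bar> < d \<longrightarrow>
        supn \<Omega> (\<lambda>x. F (u s) (v s) (w s) x - F (u t) (v t) (w t) x) < e"
      using d1(1) d2(1) d3(1) by (intro exI[of _ "min d1 (min d2 d3)"]) auto
  qed (use slice F_cont in blast)
  then show ?thesis using cont_into_C_iff[OF compact] by blast
qed

section \<open>Feasible pairs and their quantitative form\<close>

text \<open>The solution property without the integral equation: \<tau> is a delay generated by A.
  Picard iterates have this property before they solve anything.\<close>

definition feasible :: "real \<Rightarrow> (real \<Rightarrow> 'a \<Rightarrow> real) \<Rightarrow> ('a \<Rightarrow> real) \<Rightarrow> (real \<Rightarrow> 'a \<Rightarrow> real)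
    \<Rightarrow> (real \<Rightarrow> 'a \<Rightarrow> real) \<Rightarrow> bool" where
  "feasible r \<phi> \<tau>0 A \<tau> \<longleftrightarrow>
     continuous_on ({..r} \<times> \<Omega>) (\<lambda>(t, x). A t x) \<and>
     continuous_on ({0..r} \<times> \<Omega>) (\<lambda>(t, x). \<tau> t x) \<and>
     (\<forall>t\<in>{0..r}. \<forall>x\<in>\<Omega>. 0 \<le> \<tau> t x) \<and>
     (\<forall>t\<le>0. \<forall>x\<in>\<Omega>. A t x = \<phi> t x) \<and>
     (\<forall>t\<in>{0..r}. \<forall>x\<in>\<Omega>.
        integral {t - \<tau> t x..t} (\<lambda>s. f (A s) x) = integral {- \<tau>0 x..0} (\<lambda>s. f (\<phi> s) x))"

definition rhs :: "(real \<Rightarrow> 'a \<Rightarrow> real) \<Rightarrow> (real \<Rightarrow> 'a \<Rightarrow> real) \<Rightarrow> real \<Rightarrow> 'a \<Rightarrow> real" where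
  "rhs A \<tau> l x = F (A l) (\<tau> l) (\<lambda>(y, z). A (l - \<tau> l y) z) x"

lemma is_solution_iff:
  "is_solution \<Omega> F f \<phi> \<tau>0 r A \<tau> \<longleftrightarrow> feasible r \<phi> \<tau>0 A \<tau> \<and>
     (\<forall>t\<in>{0..r}. \<forall>x\<in>\<Omega>. A t x = \<phi> 0 x + integral {0..t} (\<lambda>l. rhs A \<tau> l x))"
  unfolding is_solution_def feasible_def rhs_def cont_into_C_iff[OF compact] by blast

text \<open>Starting before \<open>- \<tau>0 x\<close>, the integral of the positive integrand would
  contain the whole prescribed integral plus a positive excess. So the equation never looks at the
  history before \<open>- \<tau>0 x\<close>.\<close>

lemma feasible_delayed_time:
  assumes feas: "feasible r \<phi> \<tau>0 A \<tau>" and "0 \<le> \<tau>0 x" "t \<in> {0..r}" "x \<in> \<Omega>"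
  shows "- \<tau>0 x \<le> t - \<tau> t x"
proof (rule ccontr)
  assume "\<not> ?thesis"
  then have less: "t - \<tau> t x < - \<tau>0 x" by simp
  let ?g = "\<lambda>s. f (A s) x"
  have cont: "continuous_on ({..r} \<times> \<Omega>) (\<lambda>(t, x). A t x)"
    using feas by (simp add: feasible_def)
  have g_cont: "continuous_on {a..b} ?g" if "b \<le> r" for a b
    by (rule continuous_on_subset[OF continuous_on_slice_fst[OF f_comp_continuous[OF cont] \<open>x \<in> \<Omega>\<close>]])
      (use that in auto)
  have int: "?g integrable_on {a..b}" if "b \<le> r" for a b
    using g_cont[OF that] by (rule integrable_continuous_interval)
  have pos: "0 < ?g s" if "s \<le> r" for s
    using that \<open>x \<in> \<Omega>\<close> by (intro f_pos continuous_on_slice[OF cont]) auto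
  have nonneg: "0 \<le> integral {a..b} ?g" if "b \<le> r" for a b
    using that pos by (intro integral_nonneg int) (auto intro: less_imp_le)
  let ?a = "t - \<tau> t x" and ?b = "- \<tau>0 x"
  have b: "?b \<le> 0" "0 \<le> t" "t \<le> r" using assms by auto
  \<comment> \<open>No uniform lower bound for \<open>f\<close> is at hand here; the minimum over
    the excess interval makes the excess strictly positive.\<close>
  obtain s0 where s0: "s0 \<in> {?a..?b}" "\<And>s. s \<in> {?a..?b} \<Longrightarrow> ?g s0 \<le> ?g s"
    using continuous_attains_inf[OF compact_Icc _ g_cont[of ?b ?a]] less b by force
  have "0 < ?g s0 * (?b - ?a)"
    using pos[of s0] s0 less b by (intro mult_pos_pos) auto
  also have "\<dots> = integral {?a..?b} (\<lambda>_. ?g s0)"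
    using less by simp
  also have "\<dots> \<le> integral {?a..?b} ?g"
    using s0 b by (intro integral_le int) auto
  finally have "0 < integral {?a..?b} ?g" .
  moreover have "integral {?a..?b} ?g + integral {?b..t} ?g = integral {?a..t} ?g"
    using less b by (intro Henstock_Kurzweil_Integration.integral_combine int) auto
  moreover have "integral {?b..0} ?g + integral {0..t} ?g = integral {?b..t} ?g"
    using b by (intro Henstock_Kurzweil_Integration.integral_combine int) auto
  moreover have "integral {?b..0} ?g = integral {?b..0} (\<lambda>s. f (\<phi> s) x)"
    using feas b \<open>x \<in> \<Omega>\<close>
    by (intro integral_cong f_cong continuous_on_slice[OF cont]) (auto simp: feasible_def)
  moreover have "integral {?a..t} ?g = integral {?b..0} (\<lambda>s. f (\<phi> s) x)"
    using feas assms(3,4) by (simp add: feasible_def)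
  ultimately show False using nonneg[of t 0] b by linarith
qed

lemma delayed_continuous:
  assumes "feasible r \<phi> \<tau>0 A \<tau>"
  shows "continuous_on ({0..r} \<times> (\<Omega> \<times> \<Omega>)) (\<lambda>(l, p). (\<lambda>(y, z). A (l - \<tau> l y) z) p)"
proof -
  have A: "continuous_on ({..r} \<times> \<Omega>) (\<lambda>(t, x). A t x)"
    and \<tau>: "continuous_on ({0..r} \<times> \<Omega>) (\<lambda>(t, x). \<tau> t x)"
    and nonneg: "\<forall>t\<in>{0..r}. \<forall>x\<in>\<Omega>. 0 \<le> \<tau> t x"
    using assms by (auto simp: feasible_def)
  let ?D = "{0..r} \<times> (\<Omega> \<times> \<Omega>)"
  have "continuous_on ?D (\<lambda>q. (fst q, fst (snd q)))"
    by (intro continuous_on_Pair continuous_on_fst continuous_on_snd continuous_on_id)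
  then have "continuous_on ?D (\<lambda>q. (\<lambda>(t, x). \<tau> t x) (fst q, fst (snd q)))"
    by (rule continuous_on_compose2[OF \<tau>]) auto
  then have "continuous_on ?D (\<lambda>q. (fst q - \<tau> (fst q) (fst (snd q)), snd (snd q)))"
    by (intro continuous_on_Pair continuous_on_diff continuous_on_fst continuous_on_snd continuous_on_id) simp
  \<comment> \<open>Nonnegativity of \<tau> keeps the delayed time at most \<open>r\<close>, inside
    the domain of A.\<close>
  then have "continuous_on ?D (\<lambda>q. (\<lambda>(t, x). A t x) (fst q - \<tau> (fst q) (fst (snd q)), snd (snd q)))"
    by (rule continuous_on_compose2[OF A]) (use nonneg in fastforce)
  then show ?thesis by (simp add: case_prod_unfold)
qed

lemma rhs_continuous:
  assumes "feasible r \<phi> \<tau>0 A \<tau>"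
  shows "continuous_on ({0..r} \<times> \<Omega>) (\<lambda>(l, x). rhs A \<tau> l x)"
proof -
  have "continuous_on ({0..r} \<times> \<Omega>) (\<lambda>(t, x). A t x)"
    using assms unfolding feasible_def by (elim conjE, elim continuous_on_subset) auto
  then show ?thesis
    unfolding rhs_def using assms
    by (intro F_comp_continuous delayed_continuous[OF assms]) (auto simp: feasible_def)
qed

text \<open>The constants under which pairs can be compared, imposed only on the window from
  \<open>-m\<close> to \<open>r\<close> that the delayed times can reach. \<open>R\<close> bounds
  all three arguments of \<open>F\<close>; \<open>K\<close> is the Lipschitz constant in
  time.\<close>

definition regular :: "real \<Rightarrow> real \<Rightarrow> real \<Rightarrow> real \<Rightarrow> (real \<Rightarrow> 'a \<Rightarrow> real) \<Rightarrow> ('a \<Rightarrow> real)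
    \<Rightarrow> (real \<Rightarrow> 'a \<Rightarrow> real) \<Rightarrow> (real \<Rightarrow> 'a \<Rightarrow> real) \<Rightarrow> bool" where
  "regular r m R K \<phi> \<tau>0 A \<tau> \<longleftrightarrow> feasible r \<phi> \<tau>0 A \<tau> \<and>
     (\<forall>x\<in>\<Omega>. 0 \<le> \<tau>0 x \<and> \<tau>0 x \<le> m) \<and>
     (\<forall>t\<in>{-m..r}. \<forall>x\<in>\<Omega>. \<bar>A t x\<bar> \<le> R) \<and>
     (\<forall>t\<in>{0..r}. \<forall>x\<in>\<Omega>. \<tau> t x \<le> R) \<and>
     (\<forall>s\<in>{-m..r}. \<forall>t\<in>{-m..r}. \<forall>x\<in>\<Omega>. \<bar>A s x - A t x\<bar> \<le> K * \<bar>s - t\<bar>)"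

lemma regular_mono:
  assumes "regular r m R K \<phi> \<tau>0 A \<tau>" "R \<le> R'" "K \<le> K'"
  shows "regular r m R' K' \<phi> \<tau>0 A \<tau>"
proof -
  have "K * \<bar>s - t\<bar> \<le> K' * \<bar>s - t\<bar>" for s t :: real
    using assms(3) by (rule mult_right_mono) simp
  then show ?thesis
    using assms(1,2) unfolding regular_def by (meson order_trans)
qed

lemma regular_delayed_time:
  assumes "regular r m R K \<phi> \<tau>0 A \<tau>" "l \<in> {0..r}" "x \<in> \<Omega>"
  shows "l - \<tau> l x \<in> {-m..l}"
proof -
  have "- \<tau>0 x \<le> l - \<tau> l x"
    using assms by (intro feasible_delayed_time) (auto simp: regular_def)
  moreover have "\<tau>0 x \<le> m" "0 \<le> \<tau> l x" using assms by (auto simp: regular_def feasible_def)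
  ultimately show ?thesis by simp
qed

lemma regular_C_ball:
  assumes reg: "regular r m R K \<phi> \<tau>0 A \<tau>"
  shows "t \<in> {-m..r} \<Longrightarrow> A t \<in> C_ball \<Omega> R"
    and "l \<in> {0..r} \<Longrightarrow> A l \<in> C_ball \<Omega> R"
    and "l \<in> {0..r} \<Longrightarrow> \<tau> l \<in> C_ball \<Omega> R"
    and "l \<in> {0..r} \<Longrightarrow> (\<lambda>(y, z). A (l - \<tau> l y) z) \<in> C_ball (\<Omega> \<times> \<Omega>) R"
proof -
  have feas: "feasible r \<phi> \<tau>0 A \<tau>" using reg by (simp add: regular_def)
  have A: "continuous_on ({..r} \<times> \<Omega>) (\<lambda>(t, x). A t x)"
    and \<tau>: "continuous_on ({0..r} \<times> \<Omega>) (\<lambda>(t, x). \<tau> t x)"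
    using feas by (auto simp: feasible_def)
  show *: "A t \<in> C_ball \<Omega> R" if "t \<in> {-m..r}" for t
    using that continuous_on_slice[OF A, of t] reg unfolding C_ball_def regular_def by auto
  show "A l \<in> C_ball \<Omega> R" if "l \<in> {0..r}"
  \<comment> \<open>The sign of \<open>m\<close> is known only through a point of \<Omega>; over the
    empty set every function lies in the ball.\<close>
  proof (cases "\<Omega> = {}")
    case False
    then have "0 \<le> m" using reg unfolding regular_def by force
    then show ?thesis using * that by simp
  qed (simp add: C_ball_def)
  show "\<tau> l \<in> C_ball \<Omega> R" if "l \<in> {0..r}"
    using that continuous_on_slice[OF \<tau>, of l] reg feas
    unfolding C_ball_def regular_def feasible_def by auto
  show "(\<lambda>(y, z). A (l - \<tau> l y) z) \<in> C_ball (\<Omega> \<times> \<Omega>) R" if l: "l \<in> {0..r}"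
  proof -
    have "\<bar>A (l - \<tau> l y) z\<bar> \<le> R" if "y \<in> \<Omega>" "z \<in> \<Omega>" for y z
    proof -
      have "l - \<tau> l y \<in> {-m..r}" using regular_delayed_time[OF reg l that(1)] l by auto
      then show ?thesis using reg that(2) by (auto simp: regular_def)
    qed
    then show ?thesis
      using continuous_on_slice[OF delayed_continuous[OF feas] l] unfolding C_ball_def by auto
  qed
qed

section \<open>Dependence of the delay and of the right-hand side on A\<close>

text \<open>\<open>threshold_compare\<close> for the integrands \<open>f (A s) y\<close> and
  \<open>f (A' s) y\<close>, which differ by at most \<open>Lf * \<delta>\<close> after time 0 and
  agree before. The factor \<open>r\<close> reflects the common history.\<close>

lemma delay_compare:
  assumes reg: "regular r m R K \<phi> \<tau>0 A \<tau>" and reg': "regular r m R K \<phi> \<tau>0 A' \<tau>'"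
    and "0 < \<gamma>" and \<gamma>: "\<And>u x. u \<in> C_ball \<Omega> R \<Longrightarrow> x \<in> \<Omega> \<Longrightarrow> \<gamma> \<le> f u x"
    and l: "l \<in> {0..r}" and y: "y \<in> \<Omega>"
    and close: "\<And>s y. s \<in> {0..l} \<Longrightarrow> y \<in> \<Omega> \<Longrightarrow> \<bar>A s y - A' s y\<bar> \<le> \<delta>"
  shows "\<bar>\<tau> l y - \<tau>' l y\<bar> \<le> r * Lf / \<gamma> * \<delta>"
proof -
  have \<delta>: "0 \<le> \<delta>" using close[of 0 y] l y by auto
  have feas: "feasible r \<phi> \<tau>0 A \<tau>" "feasible r \<phi> \<tau>0 A' \<tau>'"
    using reg reg' by (auto simp: regular_def)
  then have A: "continuous_on ({..r} \<times> \<Omega>) (\<lambda>(t, x). A t x)"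
    and A': "continuous_on ({..r} \<times> \<Omega>) (\<lambda>(t, x). A' t x)"
    by (auto simp: feasible_def)
  have past: "A s y = A' s y" if "s \<le> 0" "y \<in> \<Omega>" for s y
    using feas that by (simp add: feasible_def)
  have cont: "continuous_on {-m..l} (\<lambda>s. f (A s) y)" "continuous_on {-m..l} (\<lambda>s. f (A' s) y)"
    using continuous_on_slice_fst[OF f_comp_continuous[OF A] y]
      continuous_on_slice_fst[OF f_comp_continuous[OF A'] y] l
    by (auto elim: continuous_on_subset)
  have "\<gamma> * \<bar>(l - \<tau> l y) - (l - \<tau>' l y)\<bar> \<le> l * (Lf * \<delta>)"
  proof (rule threshold_compare[OF cont])
    show "\<gamma> \<le> f (A s) y" if "s \<in> {-m..l}" for s
      using that l y by (intro \<gamma> regular_C_ball(1)[OF reg]) auto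
    show "f (A s) y = f (A' s) y" if "s \<in> {-m..0}" for s
      using that l y past by (intro f_cong continuous_on_slice[OF A]) auto
    show "\<bar>f (A s) y - f (A' s) y\<bar> \<le> Lf * \<delta>" if "s \<in> {0..l}" for s
      using that l y close by (intro f_lip continuous_on_slice[OF A] continuous_on_slice[OF A']) auto
    show "integral {l - \<tau> l y..l} (\<lambda>s. f (A s) y) = integral {l - \<tau>' l y..l} (\<lambda>s. f (A' s) y)"
      using feas l y by (simp add: feasible_def)
  qed (use regular_delayed_time[OF reg l y] regular_delayed_time[OF reg' l y] l Lf_nonneg \<delta> in auto)
  also have "\<dots> \<le> r * (Lf * \<delta>)"
    using l Lf_nonneg \<delta> by (intro mult_right_mono) auto
  finally show ?thesis
    using \<open>0 < \<gamma>\<close> by (simp add: field_simps abs_minus_commute)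
qed

text \<open>The three arguments of \<open>F\<close> contribute \<open>\<delta>\<close>,
  \<open>q * \<delta>\<close> and \<open>K * (q * \<delta>) + \<delta>\<close>. The estimate is
  causal: only differences up to time \<open>l\<close> enter, so it can be iterated under the
  integral.\<close>

lemma rhs_compare:
  assumes reg: "regular r m R K \<phi> \<tau>0 A \<tau>" and reg': "regular r m R K \<phi> \<tau>0 A' \<tau>'"
    and "0 < R" "0 \<le> K" "0 < \<gamma>" and \<gamma>: "\<And>u x. u \<in> C_ball \<Omega> R \<Longrightarrow> x \<in> \<Omega> \<Longrightarrow> \<gamma> \<le> f u x"
    and l: "l \<in> {0..r}" and x: "x \<in> \<Omega>"
    and close: "\<And>s y. s \<in> {0..l} \<Longrightarrow> y \<in> \<Omega> \<Longrightarrow> \<bar>A s y - A' s y\<bar> \<le> \<delta>"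
  shows "\<bar>rhs A \<tau> l x - rhs A' \<tau>' l x\<bar> \<le> LF R * (2 + (1 + K) * (r * Lf / \<gamma>)) * \<delta>"
proof -
  have \<delta>: "0 \<le> \<delta>" using close[of 0 x] l x by auto
  have feas: "feasible r \<phi> \<tau>0 A \<tau>" "feasible r \<phi> \<tau>0 A' \<tau>'"
    using reg reg' by (auto simp: regular_def)
  have past: "A s y = A' s y" if "s \<le> 0" "y \<in> \<Omega>" for s y
    using feas that by (simp add: feasible_def)
  define q where "q = r * Lf / \<gamma>"
  have "0 \<le> q" using l Lf_nonneg \<open>0 < \<gamma>\<close> by (simp add: q_def)
  have delay: "\<bar>\<tau> l y - \<tau>' l y\<bar> \<le> q * \<delta>" if "y \<in> \<Omega>" for y
    unfolding q_def by (rule delay_compare[OF reg reg' \<open>0 < \<gamma>\<close> \<gamma> l that close])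
  \<comment> \<open>Two changes are separated: the same A at shifted times, paid for by
    \<open>K\<close>, and A against A' at one time, which is 0 in the past.\<close>
  have delayed: "\<bar>A (l - \<tau> l y) z - A' (l - \<tau>' l y) z\<bar> \<le> K * (q * \<delta>) + \<delta>"
    if y: "y \<in> \<Omega>" and z: "z \<in> \<Omega>" for y z
  proof -
    let ?s = "l - \<tau> l y" and ?s' = "l - \<tau>' l y"
    have s: "?s \<in> {-m..l}" "?s' \<in> {-m..l}"
      using regular_delayed_time[OF reg l y] regular_delayed_time[OF reg' l y] by auto
    then have "?s \<in> {-m..r}" "?s' \<in> {-m..r}" using l by auto
    then have "\<bar>A ?s z - A ?s' z\<bar> \<le> K * \<bar>?s - ?s'\<bar>"
      using reg z unfolding regular_def by blast
    also have "\<dots> \<le> K * (q * \<delta>)"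
      using delay[OF y] \<open>0 \<le> K\<close> by (intro mult_left_mono) (auto simp: abs_minus_commute)
    finally have "\<bar>A ?s z - A ?s' z\<bar> \<le> K * (q * \<delta>)" .
    moreover have "\<bar>A ?s' z - A' ?s' z\<bar> \<le> \<delta>"
      using close[of ?s' z] past[of ?s' z] \<delta> s z by (cases "?s' \<le> 0") auto
    ultimately show ?thesis by linarith
  qed
  have "\<bar>rhs A \<tau> l x - rhs A' \<tau>' l x\<bar> \<le> LF R * (\<delta> + q * \<delta> + (K * (q * \<delta>) + \<delta>))"
    unfolding rhs_def
    by (rule F_lip[OF \<open>0 < R\<close>]) (use regular_C_ball[OF reg] regular_C_ball[OF reg'] l close delay delayed x in auto)
  also have "\<dots> = LF R * (2 + (1 + K) * q) * \<delta>" by (simp add: algebra_simps)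
  finally show ?thesis by (simp add: q_def)
qed

section \<open>Uniqueness\<close>

text \<open>\<open>rhs\<close> is continuous on a compact set, hence bounded by some
  \<open>B\<close>, and the integral equation makes the solution \<open>B\<close>-Lipschitz after 0.
  The resulting \<open>R\<close> and \<open>K\<close> depend on the solution.\<close>

lemma solution_regular:
  assumes sol: "is_solution \<Omega> F f \<phi> \<tau>0 r A \<tau>" and "0 \<le> m"
    and \<tau>0: "\<And>x. x \<in> \<Omega> \<Longrightarrow> 0 \<le> \<tau>0 x" "\<And>x. x \<in> \<Omega> \<Longrightarrow> \<tau>0 x \<le> m"
    and \<phi>_lip: "\<And>s t x. s \<in> {-m..0} \<Longrightarrow> t \<in> {-m..0} \<Longrightarrow> x \<in> \<Omega> \<Longrightarrow> \<bar>\<phi> s x - \<phi> t x\<bar> \<le> K0 * \<bar>s - t\<bar>"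
  obtains R K where "0 < R" "0 \<le> K" "regular r m R K \<phi> \<tau>0 A \<tau>"
proof -
  have feas: "feasible r \<phi> \<tau>0 A \<tau>"
    and eq: "\<And>t x. t \<in> {0..r} \<Longrightarrow> x \<in> \<Omega> \<Longrightarrow> A t x = \<phi> 0 x + integral {0..t} (\<lambda>l. rhs A \<tau> l x)"
    using sol by (auto simp: is_solution_iff)
  have A: "continuous_on ({-m..r} \<times> \<Omega>) (\<lambda>(t, x). A t x)"
    and \<tau>: "continuous_on ({0..r} \<times> \<Omega>) (\<lambda>(t, x). \<tau> t x)"
    using feas unfolding feasible_def by (auto elim: continuous_on_subset)
  note rhs = rhs_continuous[OF feas]
  have comp: "compact ({a..b} \<times> \<Omega>)" for a b :: real
    using compact by (intro compact_Times) auto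
  obtain R1 where R1: "0 < R1" "\<And>p. p \<in> {-m..r} \<times> \<Omega> \<Longrightarrow> \<bar>case p of (t, x) \<Rightarrow> A t x\<bar> \<le> R1"
    using abs_bounded_on_compact[OF comp A] by blast
  obtain R2 where R2: "0 < R2" "\<And>p. p \<in> {0..r} \<times> \<Omega> \<Longrightarrow> \<bar>case p of (t, x) \<Rightarrow> \<tau> t x\<bar> \<le> R2"
    using abs_bounded_on_compact[OF comp \<tau>] by blast
  obtain B where B: "0 < B" "\<And>p. p \<in> {0..r} \<times> \<Omega> \<Longrightarrow> \<bar>case p of (t, x) \<Rightarrow> rhs A \<tau> t x\<bar> \<le> B"
    using abs_bounded_on_compact[OF comp rhs] by blast
  \<comment> \<open>\<open>K0\<close> has no assumed sign; the sum dominates both the history's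
    constant and \<open>B\<close>.\<close>
  define K where "K = \<bar>K0\<bar> + B"
  have lip: "\<bar>A s x - A t x\<bar> \<le> K * \<bar>s - t\<bar>" if "s \<in> {-m..r}" "t \<in> {-m..r}" "x \<in> \<Omega>" for s t x
  proof (rule Lipschitz_glue[where h = "\<lambda>s. A s x", OF _ _ that(1,2)])
    fix s t assume st: "s \<in> {-m..0}" "t \<in> {-m..0}"
    have "\<bar>A s x - A t x\<bar> \<le> K0 * \<bar>s - t\<bar>"
      using feas st \<phi>_lip[OF st \<open>x \<in> \<Omega>\<close>] \<open>x \<in> \<Omega>\<close> by (simp add: feasible_def)
    also have "\<dots> \<le> K * \<bar>s - t\<bar>" using B(1) by (intro mult_right_mono) (auto simp: K_def)
    finally show "\<bar>A s x - A t x\<bar> \<le> K * \<bar>s - t\<bar>" .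
  next
    fix s t assume st: "s \<in> {0..r}" "t \<in> {0..r}"
    have "\<bar>A s x - A t x\<bar> = \<bar>integral {0..s} (\<lambda>l. rhs A \<tau> l x) - integral {0..t} (\<lambda>l. rhs A \<tau> l x)\<bar>"
      using eq[OF st(1) \<open>x \<in> \<Omega>\<close>] eq[OF st(2) \<open>x \<in> \<Omega>\<close>] by simp
    also have "\<dots> \<le> B * \<bar>s - t\<bar>"
      using B(2)[of "(_, x)"] st \<open>x \<in> \<Omega>\<close>
      by (intro integral_Lipschitz[where r = r] continuous_on_slice_fst[OF rhs]) auto
    also have "\<dots> \<le> K * \<bar>s - t\<bar>" by (intro mult_right_mono) (auto simp: K_def)
    finally show "\<bar>A s x - A t x\<bar> \<le> K * \<bar>s - t\<bar>" .
  qed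
  have "\<bar>A t x\<bar> \<le> R1 + R2" if "t \<in> {-m..r}" "x \<in> \<Omega>" for t x
    using R1(2)[of "(t, x)"] R2(1) that by simp
  moreover have "\<tau> t x \<le> R1 + R2" if "t \<in> {0..r}" "x \<in> \<Omega>" for t x
    using R2(2)[of "(t, x)"] R1(1) that by simp
  ultimately have "regular r m (R1 + R2) K \<phi> \<tau>0 A \<tau>"
    unfolding regular_def using feas lip \<tau>0 by blast
  then show thesis using that[of "R1 + R2" K] R1(1) R2(1) B(1) by (simp add: K_def)
qed

text \<open>Inserting the estimate of \<open>rhs_compare\<close> into the integral equation \<open>n\<close> times bounds the
  difference of two solutions by \<open>2 R (C t)\<^sup>n / n!\<close>.\<close>

lemma solution_unique:
  assumes sol: "is_solution \<Omega> F f \<phi> \<tau>0 r A \<tau>" "is_solution \<Omega> F f \<phi> \<tau>0 r A' \<tau>'"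
    and "0 \<le> m" "0 \<le> r"
    and \<tau>0: "\<And>x. x \<in> \<Omega> \<Longrightarrow> 0 \<le> \<tau>0 x" "\<And>x. x \<in> \<Omega> \<Longrightarrow> \<tau>0 x \<le> m"
    and \<phi>_lip: "\<And>s t x. s \<in> {-m..0} \<Longrightarrow> t \<in> {-m..0} \<Longrightarrow> x \<in> \<Omega> \<Longrightarrow> \<bar>\<phi> s x - \<phi> t x\<bar> \<le> K0 * \<bar>s - t\<bar>"
  shows "\<And>t x. t \<le> r \<Longrightarrow> x \<in> \<Omega> \<Longrightarrow> A t x = A' t x"
    and "\<And>t x. t \<in> {0..r} \<Longrightarrow> x \<in> \<Omega> \<Longrightarrow> \<tau> t x = \<tau>' t x"
proof -
  obtain R1 K1 where 1: "0 < R1" "0 \<le> K1" "regular r m R1 K1 \<phi> \<tau>0 A \<tau>"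
    using solution_regular[OF sol(1) \<open>0 \<le> m\<close> \<tau>0 \<phi>_lip] by blast
  obtain R2 K2 where 2: "0 < R2" "0 \<le> K2" "regular r m R2 K2 \<phi> \<tau>0 A' \<tau>'"
    using solution_regular[OF sol(2) \<open>0 \<le> m\<close> \<tau>0 \<phi>_lip] by blast
  \<comment> \<open>These constants come from the two given solutions, so \<open>r * C\<close> below
    need not be small.\<close>
  define R K where "R = max R1 R2" and "K = max K1 K2"
  have R: "0 < R" and K: "0 \<le> K" using 1 2 by (auto simp: R_def K_def)
  have reg: "regular r m R K \<phi> \<tau>0 A \<tau>" "regular r m R K \<phi> \<tau>0 A' \<tau>'"
    using regular_mono[OF 1(3), of R K] regular_mono[OF 2(3), of R K] by (auto simp: R_def K_def)
  then have feas: "feasible r \<phi> \<tau>0 A \<tau>" "feasible r \<phi> \<tau>0 A' \<tau>'" by (auto simp: regular_def)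
  obtain \<gamma> where \<gamma>: "0 < \<gamma>" "\<And>u x. u \<in> C_ball \<Omega> R \<Longrightarrow> x \<in> \<Omega> \<Longrightarrow> \<gamma> \<le> f u x"
    using f_lower_bound by blast
  define C where "C = LF R * (2 + (1 + K) * (r * Lf / \<gamma>))"
  have "0 \<le> C"
    unfolding C_def using LF_nonneg[OF R] K \<gamma>(1) \<open>0 \<le> r\<close> Lf_nonneg by (intro mult_nonneg_nonneg add_nonneg_nonneg) auto
  define P where "P n t = 2 * R * (C * t) ^ n / fact n" for n :: nat and t :: real
  \<comment> \<open>\<open>rhs_compare\<close> needs one bound for all times up to
    \<open>l\<close>.\<close>
  have P_mono: "P n s \<le> P n t" if "0 \<le> s" "s \<le> t" for n s t
    unfolding P_def using that \<open>0 \<le> C\<close> R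
    by (intro divide_right_mono mult_left_mono power_mono) auto
  have P_int: "((\<lambda>l. C * P n l) has_integral P (Suc n) t) {0..t}" if "0 \<le> t" for n t
  proof -
    have "(P (Suc n) has_real_derivative C * P n l) (at l within {0..t})" for l
    proof -
      have "((\<lambda>t. C * t) has_real_derivative C) (at l within {0..t})"
        by (auto intro!: derivative_eq_intros)
      from DERIV_cmult[OF DERIV_power[OF this, of "Suc n"], of "2 * R / fact (Suc n)"]
      have "((\<lambda>t. 2 * R / fact (Suc n) * (C * t) ^ Suc n) has_real_derivative
          2 * R / fact (Suc n) * (real (Suc n) * (C * (C * l) ^ n))) (at l within {0..t})"
        by simp
      moreover have "2 * R / fact (Suc n) * (real (Suc n) * (C * (C * l) ^ n)) = C * P n l"
        unfolding P_def fact_Suc by (simp del: of_nat_Suc)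
      moreover have "P (Suc n) = (\<lambda>t. 2 * R / fact (Suc n) * (C * t) ^ Suc n)"
        by (simp add: P_def fun_eq_iff)
      ultimately show ?thesis by (simp only:)
    qed
    then have "((\<lambda>l. C * P n l) has_integral (P (Suc n) t - P (Suc n) 0)) {0..t}"
      using that by (intro fundamental_theorem_of_calculus)
        (auto simp: has_real_derivative_iff_has_vector_derivative)
    then show ?thesis by (simp add: P_def)
  qed
  have close: "\<bar>A t x - A' t x\<bar> \<le> P n t" if "t \<in> {0..r}" "x \<in> \<Omega>" for n t x
    using that
  proof (induction n arbitrary: t x)
    case 0
    then have "t \<in> {-m..r}" using \<open>0 \<le> m\<close> by auto
    then have "\<bar>A t x\<bar> \<le> R" "\<bar>A' t x\<bar> \<le> R"
      using reg 0 unfolding regular_def by blast+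
    then show ?case by (simp add: P_def)
  next
    case (Suc n)
    have int: "(\<lambda>l. rhs A \<tau> l x) integrable_on {0..t}" "(\<lambda>l. rhs A' \<tau>' l x) integrable_on {0..t}"
      using Suc.prems continuous_on_slice_fst[OF rhs_continuous[OF feas(1)] Suc.prems(2)]
        continuous_on_slice_fst[OF rhs_continuous[OF feas(2)] Suc.prems(2)]
      by (auto intro!: integrable_continuous_interval elim: continuous_on_subset)
    have bound: "\<bar>rhs A \<tau> l x - rhs A' \<tau>' l x\<bar> \<le> C * P n l" if l: "l \<in> {0..t}" for l
    proof -
      have "\<bar>A s y - A' s y\<bar> \<le> P n l" if "s \<in> {0..l}" "y \<in> \<Omega>" for s y
        using Suc.IH[of s y] P_mono[of s l n] that l Suc.prems by auto
      then show ?thesis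
        unfolding C_def using l Suc.prems by (intro rhs_compare[OF reg R K \<gamma>]) auto
    qed
    have "A t x - A' t x = integral {0..t} (\<lambda>l. rhs A \<tau> l x - rhs A' \<tau>' l x)"
      using sol Suc.prems int by (simp add: is_solution_iff integral_diff)
    moreover have "norm (integral {0..t} (\<lambda>l. rhs A \<tau> l x - rhs A' \<tau>' l x)) \<le> integral {0..t} (\<lambda>l. C * P n l)"
      using P_int[of t n] Suc.prems bound
      by (intro integral_norm_bound_integral integrable_diff int) auto
    moreover have "integral {0..t} (\<lambda>l. C * P n l) = P (Suc n) t"
      by (rule integral_unique[OF P_int]) (use Suc.prems in simp)
    ultimately show ?case by simp
  qed
  have eq: "A t x = A' t x" if "t \<in> {0..r}" "x \<in> \<Omega>" for t x
  proof -
    have "(\<lambda>n. inverse (fact n) * (C * t) ^ n) \<longlonglongrightarrow> 0"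
      by (rule summable_LIMSEQ_zero[OF summable_exp])
    then have "(\<lambda>n. 2 * R * (inverse (fact n) * (C * t) ^ n)) \<longlonglongrightarrow> 2 * R * 0"
      by (rule tendsto_mult_left)
    then have "(\<lambda>n. P n t) \<longlonglongrightarrow> 0"
      by (simp add: P_def divide_inverse mult_ac)
    then have "\<bar>A t x - A' t x\<bar> \<le> 0"
      using close[OF that] by (intro LIMSEQ_le_const) auto
    then show ?thesis by simp
  qed
  show "A t x = A' t x" if "t \<le> r" "x \<in> \<Omega>" for t x
    using eq[of t x] feas that by (cases "0 \<le> t") (auto simp: feasible_def)
  show "\<tau> t x = \<tau>' t x" if "t \<in> {0..r}" "x \<in> \<Omega>" for t x
  proof -
    have "\<bar>\<tau> t x - \<tau>' t x\<bar> \<le> r * Lf / \<gamma> * 0"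
      by (rule delay_compare[OF reg \<gamma> that]) (use eq that in auto)
    then show ?thesis by simp
  qed
qed

section \<open>Existence\<close>

text \<open>Each numerical hypothesis preserves one property of the iterates:
  \<open>M0 + r * B \<le> M\<close> the bound, \<open>B \<le> K\<close> the Lipschitz constant,
  \<open>r + m \<le> R\<close> the size of the delay; \<open>small\<close> gives the factor
  1/2.\<close>

lemma solution_exists:
  assumes "0 \<le> r" "0 \<le> m" "0 < R" "0 \<le> K" "0 < \<gamma>"
    and \<phi>_cont: "continuous_on ({..0} \<times> \<Omega>) (\<lambda>(t, x). \<phi> t x)"
    and \<phi>_bound: "\<And>t x. t \<in> {-m..0} \<Longrightarrow> x \<in> \<Omega> \<Longrightarrow> \<bar>\<phi> t x\<bar> \<le> R"
    and \<phi>_lip: "\<And>s t x. s \<in> {-m..0} \<Longrightarrow> t \<in> {-m..0} \<Longrightarrow> x \<in> \<Omega> \<Longrightarrow> \<bar>\<phi> s x - \<phi> t x\<bar> \<le> K * \<bar>s - t\<bar>"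
    and \<phi>0: "\<And>x. x \<in> \<Omega> \<Longrightarrow> \<bar>\<phi> 0 x\<bar> \<le> M0"
    and \<tau>0_cont: "continuous_on \<Omega> \<tau>0"
    and \<tau>0: "\<And>x. x \<in> \<Omega> \<Longrightarrow> 0 \<le> \<tau>0 x" "\<And>x. x \<in> \<Omega> \<Longrightarrow> \<tau>0 x \<le> m"
    and F_bound: "\<And>u v w x. u \<in> C_ball \<Omega> R \<Longrightarrow> v \<in> C_ball \<Omega> R \<Longrightarrow>
      w \<in> C_ball (\<Omega> \<times> \<Omega>) R \<Longrightarrow> x \<in> \<Omega> \<Longrightarrow> \<bar>F u v w x\<bar> \<le> B"
    and \<gamma>: "\<And>u x. u \<in> C_ball \<Omega> R \<Longrightarrow> x \<in> \<Omega> \<Longrightarrow> \<gamma> \<le> f u x"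
    and "0 \<le> B" "B \<le> K" "M \<le> R" "M0 + r * B \<le> M" "r + m \<le> R"
    and small: "r * (LF R * (2 + (1 + K) * (r * Lf / \<gamma>))) \<le> 1 / 2"
  shows "\<exists>A \<tau>. is_solution \<Omega> F f \<phi> \<tau>0 r A \<tau> \<and> (\<forall>t\<in>{0..r}. \<forall>x\<in>\<Omega>. \<bar>A t x\<bar> \<le> M)"
proof -
  define S where "S = {0..r} \<times> \<Omega>"
  \<comment> \<open>The unknown lives on the compact set \<open>S\<close>; \<open>ext\<close>
    restores the history, and the condition at time 0 in \<open>X\<close> makes the two pieces
    fit.\<close>
  define ext where "ext u t = (if t \<le> 0 then \<phi> t else (\<lambda>x. u (t, x)))"
    for u :: "real \<times> 'a \<Rightarrow> real" and t :: real
  \<comment> \<open>The bound is \<open>M\<close> and not the larger \<open>R\<close>, so the fixed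
    point inherits the asserted estimate. All conditions survive uniform limits on
    \<open>S\<close>.\<close>
  define X where "X = {u. continuous_on S u \<and> (\<forall>x\<in>\<Omega>. u (0, x) = \<phi> 0 x) \<and>
    (\<forall>p\<in>S. \<bar>u p\<bar> \<le> M) \<and>
    (\<forall>s\<in>{0..r}. \<forall>t\<in>{0..r}. \<forall>x\<in>\<Omega>. \<bar>u (s, x) - u (t, x)\<bar> \<le> K * \<bar>s - t\<bar>)}"
  have ext_eq: "ext u t x = u (t, x)" if "u \<in> X" "t \<in> {0..r}" "x \<in> \<Omega>" for u t x
    using that by (cases "t = 0") (auto simp: X_def ext_def)
  have ext_past: "ext u t = \<phi> t" if "t \<le> 0" for u t
    using that by (simp add: ext_def)
  have "\<exists>\<tau>. regular r m R K \<phi> \<tau>0 (ext u) \<tau>" if u: "u \<in> X" for u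
  proof -
    have cont: "continuous_on ({..r} \<times> \<Omega>) (\<lambda>(t, x). ext u t x)"
    proof -
      have "continuous_on ({..0} \<times> \<Omega>) (\<lambda>(t, x). ext u t x)"
        by (rule continuous_on_eq[OF \<phi>_cont]) (auto simp: ext_past)
      moreover have "continuous_on S (\<lambda>(t, x). ext u t x)"
        by (rule continuous_on_eq[where f = u]) (use u ext_eq[OF u] in \<open>auto simp: X_def S_def\<close>)
      moreover have "closed ({..0::real} \<times> \<Omega>)" "closed S"
        using compact_imp_closed[OF compact] by (auto simp: S_def intro: closed_Times)
      ultimately have "continuous_on ({..0} \<times> \<Omega> \<union> S) (\<lambda>(t, x). ext u t x)"
        by (intro continuous_on_closed_Un)
      moreover have "{..0} \<times> \<Omega> \<union> S = {..r} \<times> \<Omega>" using \<open>0 \<le> r\<close> by (auto simp: S_def)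
      ultimately show ?thesis by simp
    qed
    have bound: "\<bar>ext u t x\<bar> \<le> R" if "t \<in> {-m..r}" "x \<in> \<Omega>" for t x
    proof (cases "t \<le> 0")
      case True
      then show ?thesis using \<phi>_bound[of t x] that by (simp add: ext_past)
    next
      case False
      then have "\<bar>u (t, x)\<bar> \<le> M" using u that by (simp add: X_def S_def)
      then show ?thesis using False \<open>M \<le> R\<close> by (simp add: ext_def)
    qed
    have lip: "\<bar>ext u s x - ext u t x\<bar> \<le> K * \<bar>s - t\<bar>" if "s \<in> {-m..r}" "t \<in> {-m..r}" "x \<in> \<Omega>" for s t x
    proof (rule Lipschitz_glue[where h = "\<lambda>s. ext u s x", OF _ _ that(1,2)])
      fix s t assume "s \<in> {-m..0}" "t \<in> {-m..0}"
      then show "\<bar>ext u s x - ext u t x\<bar> \<le> K * \<bar>s - t\<bar>"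
        using \<phi>_lip[of s t x] that(3) by (simp add: ext_past)
    next
      fix s t assume "s \<in> {0..r}" "t \<in> {0..r}"
      then show "\<bar>ext u s x - ext u t x\<bar> \<le> K * \<bar>s - t\<bar>"
        using u that(3) by (simp add: ext_eq[OF u] X_def)
    qed
    have low: "\<gamma> \<le> f (ext u s) x" if "s \<in> {-m..r}" "x \<in> \<Omega>" for s x
      using that bound[OF that(1)] continuous_on_slice[OF cont, of s]
      by (intro \<gamma>) (auto simp: C_ball_def)
    have gcont: "continuous_on ({-m..r} \<times> \<Omega>) (\<lambda>(s, x). f (ext u s) x)"
      by (rule continuous_on_subset[OF f_comp_continuous[OF cont]]) auto
    obtain \<tau> where \<tau>: "continuous_on ({0..r} \<times> \<Omega>) (\<lambda>(t, x). \<tau> t x)"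
      "\<And>t x. t \<in> {0..r} \<Longrightarrow> x \<in> \<Omega> \<Longrightarrow> 0 \<le> \<tau> t x"
      "\<And>t x. t \<in> {0..r} \<Longrightarrow> x \<in> \<Omega> \<Longrightarrow>
         integral {t - \<tau> t x..t} (\<lambda>s. f (ext u s) x) = integral {- \<tau>0 x..0} (\<lambda>s. f (ext u s) x)"
      using threshold_exists[OF compact \<open>0 \<le> r\<close> \<open>0 < \<gamma>\<close> gcont low \<tau>0_cont \<tau>0] by blast
    have "integral {- \<tau>0 x..0} (\<lambda>s. f (ext u s) x) = integral {- \<tau>0 x..0} (\<lambda>s. f (\<phi> s) x)" for x
      by (intro integral_cong) (auto simp: ext_past)
    then have feas: "feasible r \<phi> \<tau>0 (ext u) \<tau>"
      unfolding feasible_def using cont \<tau> by (auto simp: ext_past)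
    \<comment> \<open>From \<open>t - \<tau> t x \<ge> - \<tau>0 x\<close> the delay is at most
      \<open>r + m\<close>.\<close>
    have "\<tau> t x \<le> R" if "t \<in> {0..r}" "x \<in> \<Omega>" for t x
      using feasible_delayed_time[OF feas \<tau>0(1) that] \<tau>0(2) that \<open>r + m \<le> R\<close> by force
    then have "regular r m R K \<phi> \<tau>0 (ext u) \<tau>"
      unfolding regular_def using feas bound lip \<tau>0 by blast
    then show ?thesis by blast
  qed
  then obtain \<tau> where reg: "\<And>u. u \<in> X \<Longrightarrow> regular r m R K \<phi> \<tau>0 (ext u) (\<tau> u)" by metis
  define T where "T u p = \<phi> 0 (snd p) + integral {0..fst p} (\<lambda>l. rhs (ext u) (\<tau> u) l (snd p))"
    for u p
  have feas: "feasible r \<phi> \<tau>0 (ext u) (\<tau> u)" if "u \<in> X" for u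
    using reg[OF that] by (simp add: regular_def)
  note rhs_cont = rhs_continuous[OF feas]
  have rhs_slice: "continuous_on {a..b} (\<lambda>l. rhs (ext u) (\<tau> u) l x)"
    if "u \<in> X" "x \<in> \<Omega>" "0 \<le> a" "b \<le> r" for u x a b
    by (rule continuous_on_subset[OF continuous_on_slice_fst[OF rhs_cont]]) (use that in auto)
  have rhs_bound: "\<bar>rhs (ext u) (\<tau> u) l x\<bar> \<le> B" if "u \<in> X" "x \<in> \<Omega>" "l \<in> {0..r}" for u x l
    unfolding rhs_def using regular_C_ball[OF reg[OF that(1)]] that by (intro F_bound) auto
  have \<phi>0_cont: "continuous_on \<Omega> (\<phi> 0)" by (rule continuous_on_slice[OF \<phi>_cont]) simp
  have "M0 \<le> M" using \<open>M0 + r * B \<le> M\<close> \<open>0 \<le> r\<close> \<open>0 \<le> B\<close> by (smt (verit) mult_nonneg_nonneg)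
  have T_X: "T u \<in> X" if u: "u \<in> X" for u
    unfolding X_def
  proof (intro CollectI conjI ballI)
    have "continuous_on S (\<lambda>p. \<phi> 0 (snd p))"
      by (rule continuous_on_compose2[OF \<phi>0_cont]) (auto simp: S_def intro: continuous_intros)
    then show "continuous_on S (T u)"
      unfolding T_def S_def
      using integral_continuous_Times[OF compact rhs_cont[OF u]]
      by (intro continuous_on_add) (simp_all add: case_prod_unfold)
    show "T u (0, x) = \<phi> 0 x" for x by (simp add: T_def)
    show "\<bar>T u p\<bar> \<le> M" if pS: "p \<in> S" for p
    proof -
      obtain t x where p: "p = (t, x)" "t \<in> {0..r}" "x \<in> \<Omega>" using pS by (auto simp: S_def)
      have "norm (integral {0..t} (\<lambda>l. rhs (ext u) (\<tau> u) l x)) \<le> B * (t - 0)"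
        using p by (intro integral_bound rhs_slice u) (auto intro: rhs_bound u)
      also have "\<dots> \<le> r * B" using p \<open>0 \<le> B\<close> by (simp add: mult.commute[of r] mult_left_mono)
      finally show ?thesis
        using p \<phi>0[of x] \<open>M0 + r * B \<le> M\<close> by (simp add: T_def)
    qed
    show "\<bar>T u (s, x) - T u (t, x)\<bar> \<le> K * \<bar>s - t\<bar>"
      if "s \<in> {0..r}" "t \<in> {0..r}" "x \<in> \<Omega>" for s t x
    proof -
      have "\<bar>T u (s, x) - T u (t, x)\<bar> \<le> B * \<bar>s - t\<bar>"
        using integral_Lipschitz[OF rhs_slice[OF u that(3) order_refl order_refl] rhs_bound[OF u that(3)] that(1,2)]
        by (simp add: T_def)
      also have "\<dots> \<le> K * \<bar>s - t\<bar>" using \<open>B \<le> K\<close> by (intro mult_right_mono) auto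
      finally show ?thesis .
    qed
  qed
  have "\<exists>u\<in>X. \<forall>p\<in>S. T u p = u p"
  proof (rule uniform_fixed_point)
    show u0: "(\<lambda>p. \<phi> 0 (snd p)) \<in> X"
    proof -
      have "continuous_on S (\<lambda>p. \<phi> 0 (snd p))"
        by (rule continuous_on_compose2[OF \<phi>0_cont]) (auto simp: S_def intro: continuous_intros)
      then show ?thesis
        using \<phi>0 \<open>M0 \<le> M\<close> \<open>0 \<le> K\<close> by (fastforce simp: X_def S_def)
    qed
    show "T u \<in> X" if "u \<in> X" for u by (rule T_X[OF that])
    \<comment> \<open>Both functions lie in \<open>X\<close>; the absolute value covers
      \<open>M\<close>, whose sign is not assumed.\<close>
    show "\<bar>T (\<lambda>p. \<phi> 0 (snd p)) p - \<phi> 0 (snd p)\<bar> \<le> 2 * \<bar>M\<bar>" if "p \<in> S" for p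
    proof -
      have "\<bar>T (\<lambda>p. \<phi> 0 (snd p)) p\<bar> \<le> M" "\<bar>\<phi> 0 (snd p)\<bar> \<le> M"
        using T_X[OF u0] u0 that by (auto simp: X_def)
      then show ?thesis by linarith
    qed
    show "\<bar>T u p - T v p\<bar> \<le> d / 2"
      if uv: "u \<in> X" "v \<in> X" and "0 \<le> d" and d: "\<And>p. p \<in> S \<Longrightarrow> \<bar>u p - v p\<bar> \<le> d" and "p \<in> S" for u v d p
    proof -
      obtain t x where p: "p = (t, x)" "t \<in> {0..r}" "x \<in> \<Omega>" using \<open>p \<in> S\<close> by (auto simp: S_def)
      define C where "C = LF R * (2 + (1 + K) * (r * Lf / \<gamma>))"
      have "0 \<le> C"
        unfolding C_def using LF_nonneg[OF \<open>0 < R\<close>] \<open>0 \<le> K\<close> \<open>0 < \<gamma>\<close> \<open>0 \<le> r\<close> Lf_nonneg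
        by (intro mult_nonneg_nonneg add_nonneg_nonneg) auto
      have bound: "\<bar>rhs (ext u) (\<tau> u) l x - rhs (ext v) (\<tau> v) l x\<bar> \<le> C * d" if l: "l \<in> {0..r}" for l
      proof -
        have "\<bar>ext u s y - ext v s y\<bar> \<le> d" if "s \<in> {0..l}" "y \<in> \<Omega>" for s y
          using that l d[of "(s, y)"] by (simp add: ext_eq uv S_def)
        then show ?thesis
          unfolding C_def
          by (intro rhs_compare[OF reg[OF uv(1)] reg[OF uv(2)] \<open>0 < R\<close> \<open>0 \<le> K\<close> \<open>0 < \<gamma>\<close> \<gamma> l p(3)])
      qed
      have "(\<lambda>l. rhs (ext u) (\<tau> u) l x) integrable_on {0..t}" "(\<lambda>l. rhs (ext v) (\<tau> v) l x) integrable_on {0..t}"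
        using p by (auto intro!: integrable_continuous_interval rhs_slice uv)
      then have "T u p - T v p = integral {0..t} (\<lambda>l. rhs (ext u) (\<tau> u) l x - rhs (ext v) (\<tau> v) l x)"
        by (simp add: T_def p(1) integral_diff)
      moreover have "norm (integral {0..t} (\<lambda>l. rhs (ext u) (\<tau> u) l x - rhs (ext v) (\<tau> v) l x)) \<le> C * d * (t - 0)"
        using p by (intro integral_bound continuous_on_diff rhs_slice uv) (auto intro: bound)
      ultimately have "\<bar>T u p - T v p\<bar> \<le> C * d * (t - 0)" by simp
      also have "\<dots> \<le> C * d * r" using p \<open>0 \<le> C\<close> \<open>0 \<le> d\<close> by (intro mult_left_mono) auto
      also have "\<dots> = (r * C) * d" by simp
      also have "\<dots> \<le> 1 / 2 * d" using small \<open>0 \<le> d\<close> unfolding C_def by (intro mult_right_mono)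
      finally show ?thesis by simp
    qed
    show "u \<in> X" if g: "\<And>n::nat. g n \<in> X" and lim: "uniform_limit S g u sequentially" for u g
    proof -
      have pt: "(\<lambda>n. g n p) \<longlonglongrightarrow> u p" if "p \<in> S" for p
        by (rule tendsto_uniform_limitI[OF lim that])
      have "continuous_on S u"
        using g by (intro uniform_limit_theorem[OF _ lim]) (auto simp: X_def)
      moreover have "u (0, x) = \<phi> 0 x" if "x \<in> \<Omega>" for x
      proof -
        have "(\<lambda>n. g n (0, x)) \<longlonglongrightarrow> u (0, x)" using that \<open>0 \<le> r\<close> by (intro pt) (auto simp: S_def)
        then show ?thesis using g that by (simp add: X_def LIMSEQ_const_iff)
      qed
      moreover have "\<bar>u p\<bar> \<le> M" if "p \<in> S" for p
        using tendsto_rabs[OF pt[OF that]] g that by (intro LIMSEQ_le_const2) (auto simp: X_def)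
      moreover have "\<bar>u (s, x) - u (t, x)\<bar> \<le> K * \<bar>s - t\<bar>"
        if "s \<in> {0..r}" "t \<in> {0..r}" "x \<in> \<Omega>" for s t x
      proof -
        have "(\<lambda>n. \<bar>g n (s, x) - g n (t, x)\<bar>) \<longlonglongrightarrow> \<bar>u (s, x) - u (t, x)\<bar>"
          using that by (intro tendsto_rabs tendsto_diff pt) (auto simp: S_def)
        then show ?thesis using g that by (intro LIMSEQ_le_const2) (auto simp: X_def)
      qed
      ultimately show ?thesis unfolding X_def by blast
    qed
  qed simp
  then obtain u where u: "u \<in> X" "\<And>p. p \<in> S \<Longrightarrow> T u p = u p" by blast
  show ?thesis
  proof (intro exI conjI ballI)
    show "is_solution \<Omega> F f \<phi> \<tau>0 r (ext u) (\<tau> u)"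
      unfolding is_solution_iff
    proof (intro conjI ballI feas u(1))
      fix t x assume "t \<in> {0..r}" "x \<in> \<Omega>"
      then show "ext u t x = \<phi> 0 x + integral {0..t} (\<lambda>l. rhs (ext u) (\<tau> u) l x)"
        using u(2)[of "(t, x)"] by (simp add: ext_eq[OF u(1)] S_def T_def)
    qed
    show "\<bar>ext u t x\<bar> \<le> M" if "t \<in> {0..r}" "x \<in> \<Omega>" for t x
      using that u(1) by (simp add: ext_eq[OF u(1)] X_def S_def)
  qed
qed

end

section \<open>Histories in the weighted space\<close>

text \<open>The norm is a sum of two suprema. Membership bounds both sets, so the suprema are
  genuine; both are nonnegative, so each is at most \<open>N\<close>.\<close>

lemma Lip_alpha_bounds:
  fixes \<Omega> :: "'a::euclidean_space set"
  assumes "compact \<Omega>" and \<phi>: "in_Lip_alpha \<Omega> \<alpha> \<phi>" and N: "Lip_alpha_norm \<Omega> \<alpha> \<phi> \<le> N"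
  shows "\<And>\<theta> x. \<theta> \<le> 0 \<Longrightarrow> x \<in> \<Omega> \<Longrightarrow> \<bar>wgt \<alpha> \<phi> \<theta> x\<bar> \<le> N"
    and "\<And>\<theta> \<theta>' x. \<theta> \<le> 0 \<Longrightarrow> \<theta>' \<le> 0 \<Longrightarrow> x \<in> \<Omega> \<Longrightarrow>
      \<bar>wgt \<alpha> \<phi> \<theta> x - wgt \<alpha> \<phi> \<theta>' x\<bar> \<le> N * \<bar>\<theta> - \<theta>'\<bar>"
proof -
  have cont: "continuous_on \<Omega> (wgt \<alpha> \<phi> \<theta>)" if "\<theta> \<le> 0" for \<theta>
    using \<phi> that unfolding in_Lip_alpha_def cont_into_C_def wgt_def
    by (auto intro!: continuous_intros)
  have contd: "continuous_on \<Omega> (\<lambda>x. wgt \<alpha> \<phi> \<theta> x - wgt \<alpha> \<phi> \<theta>' x)" if "\<theta> \<le> 0" "\<theta>' \<le> 0" for \<theta> \<theta>'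
    by (intro continuous_on_diff cont that)
  define Q where "Q = {supn \<Omega> (\<lambda>x. wgt \<alpha> \<phi> \<theta> x - wgt \<alpha> \<phi> \<theta>' x) / \<bar>\<theta> - \<theta>'\<bar> | \<theta> \<theta>'.
              \<theta> \<le> 0 \<and> \<theta>' \<le> 0 \<and> \<theta> \<noteq> \<theta>'}"
  define W where "W = (\<lambda>\<theta>. supn \<Omega> (wgt \<alpha> \<phi> \<theta>)) ` {..0}"
  have norm: "Sup W + Sup Q \<le> N" using N by (simp add: Lip_alpha_norm_def W_def Q_def)
  have "bdd_above W" using \<phi> by (simp add: in_Lip_alpha_def W_def)
  have W: "supn \<Omega> (wgt \<alpha> \<phi> \<theta>) \<le> Sup W" if "\<theta> \<le> 0" for \<theta>
    using that \<open>bdd_above W\<close> by (intro cSup_upper) (auto simp: W_def)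
  have "0 \<le> Sup W"
    using W[of 0] supn_nonneg[OF \<open>compact \<Omega>\<close> cont[of 0]] by simp
  obtain L where L: "\<And>\<theta> \<theta>'. \<theta> \<le> 0 \<Longrightarrow> \<theta>' \<le> 0 \<Longrightarrow>
      supn \<Omega> (\<lambda>x. wgt \<alpha> \<phi> \<theta> x - wgt \<alpha> \<phi> \<theta>' x) \<le> L * \<bar>\<theta> - \<theta>'\<bar>"
    using \<phi> unfolding in_Lip_alpha_def by blast
  have "bdd_above Q"
    by (rule bdd_aboveI[of _ L]) (auto simp: Q_def pos_divide_le_eq intro: L)
  have Q: "supn \<Omega> (\<lambda>x. wgt \<alpha> \<phi> \<theta> x - wgt \<alpha> \<phi> \<theta>' x) / \<bar>\<theta> - \<theta>'\<bar> \<le> Sup Q"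
    if "\<theta> \<le> 0" "\<theta>' \<le> 0" "\<theta> \<noteq> \<theta>'" for \<theta> \<theta>'
    using that \<open>bdd_above Q\<close> by (intro cSup_upper) (auto simp: Q_def)
  \<comment> \<open>Any two distinct times would do; they exhibit one nonnegative quotient in
    \<open>Q\<close>.\<close>
  have "0 \<le> Sup Q"
    using Q[of 0 "-1"] supn_nonneg[OF \<open>compact \<Omega>\<close> contd[of 0 "-1"]] by simp
  show "\<bar>wgt \<alpha> \<phi> \<theta> x\<bar> \<le> N" if "\<theta> \<le> 0" "x \<in> \<Omega>" for \<theta> x
    using abs_le_supn[OF \<open>compact \<Omega>\<close> cont[OF that(1)] that(2)] W[OF that(1)] \<open>0 \<le> Sup Q\<close> norm
    by linarith
  show "\<bar>wgt \<alpha> \<phi> \<theta> x - wgt \<alpha> \<phi> \<theta>' x\<bar> \<le> N * \<bar>\<theta> - \<theta>'\<bar>" if "\<theta> \<le> 0" "\<theta>' \<le> 0" "x \<in> \<Omega>" for \<theta> \<theta>' x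
  proof (cases "\<theta> = \<theta>'")
    case False
    have "\<bar>wgt \<alpha> \<phi> \<theta> x - wgt \<alpha> \<phi> \<theta>' x\<bar> \<le> supn \<Omega> (\<lambda>x. wgt \<alpha> \<phi> \<theta> x - wgt \<alpha> \<phi> \<theta>' x)"
      using abs_le_supn[OF \<open>compact \<Omega>\<close> contd[OF that(1,2)] that(3)] .
    also have "\<dots> \<le> Sup Q * \<bar>\<theta> - \<theta>'\<bar>"
      using Q[OF that(1,2) False] False by (simp add: pos_divide_le_eq)
    also have "\<dots> \<le> N * \<bar>\<theta> - \<theta>'\<bar>"
      using norm \<open>0 \<le> Sup W\<close> by (intro mult_right_mono) auto
    finally show ?thesis .
  qed simp
qed

text \<open>The mean value estimate for exp, obtained from \<open>1 + x \<le> exp x\<close> at the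
  difference of the exponents.\<close>

lemma abs_exp_diff_le:
  fixes a b c :: real
  assumes "a \<le> c" "b \<le> c"
  shows "\<bar>exp a - exp b\<bar> \<le> exp c * \<bar>a - b\<bar>"
proof -
  have *: "exp b - exp a \<le> exp c * (b - a)" if "a \<le> b" "b \<le> c" for a b :: real
  proof -
    have "exp b * (1 + (a - b)) \<le> exp b * exp (a - b)"
      by (intro mult_left_mono exp_ge_add_one_self) simp
    then have "exp b - exp a \<le> exp b * (b - a)"
      by (simp add: exp_diff algebra_simps)
    also have "\<dots> \<le> exp c * (b - a)" using that by (intro mult_right_mono) auto
    finally show ?thesis .
  qed
  show ?thesis
  proof (cases "a \<le> b")
    case True
    then have "exp a \<le> exp b" by simp
    then show ?thesis using *[OF True] assms True by (simp add: abs_if)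
  next
    case False
    then have "exp b \<le> exp a" by simp
    then show ?thesis using *[of b a] assms False by (simp add: abs_if)
  qed
qed

text \<open>On the window the inverse weight is at most \<open>exp (\<alpha> * m)\<close> with
  Lipschitz constant \<alpha> times that. The product rule then yields the factor
  \<open>1 + \<alpha>\<close>.\<close>

lemma Lip_alpha_bounds_unweighted:
  fixes \<Omega> :: "'a::euclidean_space set"
  assumes "compact \<Omega>" "0 \<le> \<alpha>" and \<phi>: "in_Lip_alpha \<Omega> \<alpha> \<phi>" and N: "Lip_alpha_norm \<Omega> \<alpha> \<phi> \<le> N"
  shows "\<And>\<theta> x. \<theta> \<in> {-m..0} \<Longrightarrow> x \<in> \<Omega> \<Longrightarrow> \<bar>\<phi> \<theta> x\<bar> \<le> exp (\<alpha> * m) * N"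
    and "\<And>\<theta> \<theta>' x. \<theta> \<in> {-m..0} \<Longrightarrow> \<theta>' \<in> {-m..0} \<Longrightarrow> x \<in> \<Omega> \<Longrightarrow>
      \<bar>\<phi> \<theta> x - \<phi> \<theta>' x\<bar> \<le> exp (\<alpha> * m) * N * (1 + \<alpha>) * \<bar>\<theta> - \<theta>'\<bar>"
proof -
  note w = Lip_alpha_bounds[OF assms(1,3,4)]
  have eq: "\<phi> \<theta> x = exp (- \<alpha> * \<theta>) * wgt \<alpha> \<phi> \<theta> x" if "\<theta> \<le> 0" for \<theta> x
    using that by (simp add: wgt_def flip: mult.assoc exp_add)
  have e: "- \<alpha> * \<theta> \<le> \<alpha> * m" if "\<theta> \<in> {-m..0}" for \<theta>
  proof -
    have "\<alpha> * - \<theta> \<le> \<alpha> * m" using that \<open>0 \<le> \<alpha>\<close> by (intro mult_left_mono) auto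
    then show ?thesis by simp
  qed
  show "\<bar>\<phi> \<theta> x\<bar> \<le> exp (\<alpha> * m) * N" if "\<theta> \<in> {-m..0}" "x \<in> \<Omega>" for \<theta> x
    using that e[OF that(1)] w(1)[of \<theta> x]
    by (subst eq) (auto simp: abs_mult intro!: mult_mono)
  show "\<bar>\<phi> \<theta> x - \<phi> \<theta>' x\<bar> \<le> exp (\<alpha> * m) * N * (1 + \<alpha>) * \<bar>\<theta> - \<theta>'\<bar>"
    if \<theta>: "\<theta> \<in> {-m..0}" "\<theta>' \<in> {-m..0}" and x: "x \<in> \<Omega>" for \<theta> \<theta>' x
  proof -
    let ?a = "exp (- \<alpha> * \<theta>) * (wgt \<alpha> \<phi> \<theta> x - wgt \<alpha> \<phi> \<theta>' x)"
    let ?b = "(exp (- \<alpha> * \<theta>) - exp (- \<alpha> * \<theta>')) * wgt \<alpha> \<phi> \<theta>' x"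
    have "\<phi> \<theta> x - \<phi> \<theta>' x = ?a + ?b"
      using \<theta> eq[of \<theta> x] eq[of \<theta>' x] by (simp add: algebra_simps)
    then have "\<bar>\<phi> \<theta> x - \<phi> \<theta>' x\<bar> \<le> \<bar>?a\<bar> + \<bar>?b\<bar>"
      using abs_triangle_ineq[of ?a ?b] by (simp only:)
    also have "\<dots> = exp (- \<alpha> * \<theta>) * \<bar>wgt \<alpha> \<phi> \<theta> x - wgt \<alpha> \<phi> \<theta>' x\<bar>
        + \<bar>exp (- \<alpha> * \<theta>) - exp (- \<alpha> * \<theta>')\<bar> * \<bar>wgt \<alpha> \<phi> \<theta>' x\<bar>"
      by (simp only: abs_mult abs_exp_cancel)
    also have "\<dots> \<le> exp (\<alpha> * m) * (N * \<bar>\<theta> - \<theta>'\<bar>) + (exp (\<alpha> * m) * \<bar>- \<alpha> * \<theta> - - \<alpha> * \<theta>'\<bar>) * N"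
    proof (rule add_mono)
      show "exp (- \<alpha> * \<theta>) * \<bar>wgt \<alpha> \<phi> \<theta> x - wgt \<alpha> \<phi> \<theta>' x\<bar> \<le> exp (\<alpha> * m) * (N * \<bar>\<theta> - \<theta>'\<bar>)"
        using \<theta> x e[OF \<theta>(1)] by (intro mult_mono w) auto
      show "\<bar>exp (- \<alpha> * \<theta>) - exp (- \<alpha> * \<theta>')\<bar> * \<bar>wgt \<alpha> \<phi> \<theta>' x\<bar>
          \<le> (exp (\<alpha> * m) * \<bar>- \<alpha> * \<theta> - - \<alpha> * \<theta>'\<bar>) * N"
        by (rule mult_mono[OF abs_exp_diff_le[OF e[OF \<theta>(1)] e[OF \<theta>(2)]] w(1)]) (use \<theta> x in auto)
    qed
    also have "\<bar>- \<alpha> * \<theta> - - \<alpha> * \<theta>'\<bar> = \<alpha> * \<bar>\<theta> - \<theta>'\<bar>"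
    proof -
      have "- \<alpha> * \<theta> - - \<alpha> * \<theta>' = \<alpha> * (\<theta>' - \<theta>)" by (simp add: algebra_simps)
      then show ?thesis using \<open>0 \<le> \<alpha>\<close> by (simp add: abs_mult abs_minus_commute)
    qed
    finally show ?thesis by (simp add: algebra_simps)
  qed
qed

section \<open>Passage to the locale and choice of r\<close>

lemma delay_system_exists:
  fixes \<Omega> :: "'a::euclidean_space set"
  assumes "compact \<Omega>" and F: "F_assm \<Omega> F" and f: "f_assm \<Omega> f Mf"
  shows "\<exists>LF Lf. delay_system \<Omega> F f LF Lf"
proof -
  have compact2: "compact (\<Omega> \<times> \<Omega>)" using \<open>compact \<Omega>\<close> by (intro compact_Times)
  note F = F[unfolded F_assm_def] and f = f[unfolded f_assm_def]
  obtain Lf where Lf: "\<forall>u v. continuous_on \<Omega> u \<and> continuous_on \<Omega> v \<longrightarrow>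
      supn \<Omega> (\<lambda>x. f u x - f v x) \<le> Lf * supn \<Omega> (\<lambda>x. u x - v x)"
    using f[THEN conjunct2, THEN conjunct1] by (rule exE)
  have f_cont: "continuous_on \<Omega> (f u)" if "continuous_on \<Omega> u" for u
    using f[THEN conjunct1] that by blast
  have F_cont: "continuous_on \<Omega> (F u v w)"
    if "continuous_on \<Omega> u" "continuous_on \<Omega> v" "continuous_on (\<Omega> \<times> \<Omega>) w" for u v w
    using F[THEN conjunct1] that by blast
  define P where "P R L \<longleftrightarrow> (\<forall>u v w u' v' w'.
        continuous_on \<Omega> u \<and> continuous_on \<Omega> v \<and> continuous_on (\<Omega> \<times> \<Omega>) w \<and>
        continuous_on \<Omega> u' \<and> continuous_on \<Omega> v' \<and> continuous_on (\<Omega> \<times> \<Omega>) w' \<and>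
        supn \<Omega> u \<le> R \<and> supn \<Omega> v \<le> R \<and> supn (\<Omega> \<times> \<Omega>) w \<le> R \<and>
        supn \<Omega> u' \<le> R \<and> supn \<Omega> v' \<le> R \<and> supn (\<Omega> \<times> \<Omega>) w' \<le> R
        \<longrightarrow> supn \<Omega> (\<lambda>x. F u v w x - F u' v' w' x)
              \<le> L * (supn \<Omega> (\<lambda>x. u x - u' x) + supn \<Omega> (\<lambda>x. v x - v' x)
                     + supn (\<Omega> \<times> \<Omega>) (\<lambda>p. w p - w' p)))"
    for R L
  have "\<exists>L. P R L" if "0 < R" for R
    unfolding P_def by (rule F[THEN conjunct2, THEN spec, THEN mp, OF that])
  then obtain LF where LF: "\<And>R. 0 < R \<Longrightarrow> P R (LF R)" by metis
  \<comment> \<open>The assumed constants carry no sign; absolute values make them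
    nonnegative.\<close>
  have "delay_system \<Omega> F f (\<lambda>R. \<bar>LF R\<bar>) \<bar>Lf\<bar>"
  proof
    fix R :: real and u v w u' v' w' and a b c :: real and x
    assume R: "0 < R"
      and ball: "u \<in> C_ball \<Omega> R" "v \<in> C_ball \<Omega> R" "w \<in> C_ball (\<Omega> \<times> \<Omega>) R"
        "u' \<in> C_ball \<Omega> R" "v' \<in> C_ball \<Omega> R" "w' \<in> C_ball (\<Omega> \<times> \<Omega>) R"
      and abc: "\<And>y. y \<in> \<Omega> \<Longrightarrow> \<bar>u y - u' y\<bar> \<le> a" "\<And>y. y \<in> \<Omega> \<Longrightarrow> \<bar>v y - v' y\<bar> \<le> b"
        "\<And>y z. y \<in> \<Omega> \<Longrightarrow> z \<in> \<Omega> \<Longrightarrow> \<bar>w (y, z) - w' (y, z)\<bar> \<le> c"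
      and x: "x \<in> \<Omega>"
    have cont: "continuous_on \<Omega> u" "continuous_on \<Omega> v" "continuous_on (\<Omega> \<times> \<Omega>) w"
        "continuous_on \<Omega> u'" "continuous_on \<Omega> v'" "continuous_on (\<Omega> \<times> \<Omega>) w'"
      using ball by (auto simp: C_ball_def)
    have ball_le: "supn S g \<le> R" if "g \<in> C_ball S R" for S :: "'c::topological_space set" and g
      using that R by (intro supn_least) (auto simp: C_ball_def)
    let ?d = "supn \<Omega> (\<lambda>x. u x - u' x) + supn \<Omega> (\<lambda>x. v x - v' x) + supn (\<Omega> \<times> \<Omega>) (\<lambda>p. w p - w' p)"
    have "0 \<le> ?d"
      by (intro add_nonneg_nonneg supn_nonneg continuous_on_diff cont \<open>compact \<Omega>\<close> compact2)
    \<comment> \<open>The point \<open>x\<close> shows that \<Omega> is nonempty, which forces the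
      bounds to be nonnegative.\<close>
    have "0 \<le> a" "0 \<le> b" "0 \<le> c" using abc(1)[OF x] abc(2)[OF x] abc(3)[OF x x] by auto
    then have "?d \<le> a + b + c"
      by (intro add_mono supn_least) (use abc in auto)
    have "\<bar>F u v w x - F u' v' w' x\<bar> \<le> supn \<Omega> (\<lambda>x. F u v w x - F u' v' w' x)"
      by (rule abs_le_supn[OF \<open>compact \<Omega>\<close> _ x, where g = "\<lambda>x. F u v w x - F u' v' w' x"])
        (intro continuous_on_diff F_cont cont)
    also have "\<dots> \<le> LF R * ?d" using cont ball by (intro LF[OF R, unfolded P_def, rule_format] conjI ball_le)
    also have "\<dots> \<le> \<bar>LF R\<bar> * ?d" using \<open>0 \<le> ?d\<close> by (intro mult_right_mono) auto
    also have "\<dots> \<le> \<bar>LF R\<bar> * (a + b + c)" using \<open>?d \<le> a + b + c\<close> by (intro mult_left_mono) auto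
    finally show "\<bar>F u v w x - F u' v' w' x\<bar> \<le> \<bar>LF R\<bar> * (a + b + c)" .
  next
    fix u v :: "'a \<Rightarrow> real" and a x
    assume cont: "continuous_on \<Omega> u" "continuous_on \<Omega> v"
      and a: "\<And>y. y \<in> \<Omega> \<Longrightarrow> \<bar>u y - v y\<bar> \<le> a" and x: "x \<in> \<Omega>"
    let ?d = "supn \<Omega> (\<lambda>x. u x - v x)"
    have "0 \<le> ?d" by (intro supn_nonneg continuous_on_diff cont \<open>compact \<Omega>\<close>)
    have "?d \<le> a" using a[OF x] by (intro supn_least a) auto
    have "\<bar>f u x - f v x\<bar> \<le> supn \<Omega> (\<lambda>x. f u x - f v x)"
      by (rule abs_le_supn[OF \<open>compact \<Omega>\<close> _ x, where g = "\<lambda>x. f u x - f v x"])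
        (intro continuous_on_diff f_cont cont)
    also have "\<dots> \<le> Lf * ?d" by (intro Lf[rule_format] conjI cont)
    also have "\<dots> \<le> \<bar>Lf\<bar> * ?d" using \<open>0 \<le> ?d\<close> by (intro mult_right_mono) auto
    also have "\<dots> \<le> \<bar>Lf\<bar> * a" using \<open>?d \<le> a\<close> by (intro mult_left_mono) auto
    finally show "\<bar>f u x - f v x\<bar> \<le> \<bar>Lf\<bar> * a" .
  next
    fix u :: "'a \<Rightarrow> real" and x assume "continuous_on \<Omega> u" "x \<in> \<Omega>"
    then show "0 < f u x" using f[THEN conjunct2, THEN conjunct2, THEN conjunct1] by blast
  next
    fix u v :: "'a \<Rightarrow> real" and x assume "continuous_on \<Omega> u" "continuous_on \<Omega> v" "\<And>y. y \<in> \<Omega> \<Longrightarrow> u y \<le> v y" "x \<in> \<Omega>"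
    then show "f v x \<le> f u x"
      using f[THEN conjunct2, THEN conjunct2, THEN conjunct2, rule_format, of u v x] by blast
  qed (use \<open>compact \<Omega>\<close> F_cont f_cont in simp_all)
  then show ?thesis by blast
qed

theorem theorem4p4:
  fixes \<Omega> :: "'a::euclidean_space set"
    and F :: "('a \<Rightarrow> real) \<Rightarrow> ('a \<Rightarrow> real) \<Rightarrow> ('a \<times> 'a \<Rightarrow> real) \<Rightarrow> ('a \<Rightarrow> real)"
    and f :: "('a \<Rightarrow> real) \<Rightarrow> ('a \<Rightarrow> real)"
    and \<alpha> Mf M0 M :: real
  assumes "compact \<Omega>"
    and "0 \<le> \<alpha>"
    and "F_assm \<Omega> F"
    and "f_assm \<Omega> f Mf"
    and "0 < M0" and "M0 < M"
  shows "\<exists>r>0. \<forall>\<phi> \<tau>0.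
           in_Lip_alpha \<Omega> \<alpha> \<phi> \<and> continuous_on \<Omega> \<tau>0 \<and> (\<forall>x\<in>\<Omega>. 0 \<le> \<tau>0 x) \<and>
           Lip_alpha_norm \<Omega> \<alpha> \<phi> + supn \<Omega> \<tau>0 \<le> M0
           \<longrightarrow> (\<exists>A \<tau>. is_solution \<Omega> F f \<phi> \<tau>0 r A \<tau> \<and> (\<forall>t\<in>{0..r}. supn \<Omega> (A t) \<le> M)) \<and>
               (\<forall>A \<tau> A' \<tau>'. is_solution \<Omega> F f \<phi> \<tau>0 r A \<tau> \<and> is_solution \<Omega> F f \<phi> \<tau>0 r A' \<tau>'
                  \<longrightarrow> (\<forall>t\<le>r. \<forall>x\<in>\<Omega>. A t x = A' t x) \<and> (\<forall>t\<in>{0..r}. \<forall>x\<in>\<Omega>. \<tau> t x = \<tau>' t x))"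
proof -
  obtain LF Lf where "delay_system \<Omega> F f LF Lf"
    using delay_system_exists[OF assms(1,3,4)] by blast
  then interpret delay_system \<Omega> F f LF Lf .
  \<comment> \<open>The summands cover in turn the solution after 0, the unweighted history on the
    window, and the delay, which is at most \<open>r + M0 \<le> 1 + M0\<close>.\<close>
  define R where "R = M + exp (\<alpha> * M0) * M0 + 1 + M0"
  have R: "0 < R" "M \<le> R" "exp (\<alpha> * M0) * M0 \<le> R" "1 + M0 \<le> R"
    using assms(5,6) by (auto simp: R_def intro!: add_pos_pos)
  obtain B where B: "0 \<le> B" "\<And>u v w x. u \<in> C_ball \<Omega> R \<Longrightarrow> v \<in> C_ball \<Omega> R \<Longrightarrow>
      w \<in> C_ball (\<Omega> \<times> \<Omega>) R \<Longrightarrow> x \<in> \<Omega> \<Longrightarrow> \<bar>F u v w x\<bar> \<le> B"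
    using F_bounded[OF R(1)] by blast
  obtain \<gamma> where \<gamma>: "0 < \<gamma>" "\<And>u x. u \<in> C_ball \<Omega> R \<Longrightarrow> x \<in> \<Omega> \<Longrightarrow> \<gamma> \<le> f u x"
    using f_lower_bound by blast
  define K0 where "K0 = exp (\<alpha> * M0) * M0 * (1 + \<alpha>)"
  define K where "K = K0 + B"
  have "0 \<le> K0" using assms(2,5) by (simp add: K0_def)
  then have K: "0 \<le> K" "K0 \<le> K" "B \<le> K" using B(1) by (auto simp: K_def)
  \<comment> \<open>The factor \<open>r\<close> in front of \<open>Lf / \<gamma>\<close> is
    estimated by 1, so that \<open>C\<close> is available before \<open>r\<close> is chosen.\<close>
  define C where "C = LF R * (2 + (1 + K) * (Lf / \<gamma>))"
  have "0 \<le> C"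
    unfolding C_def using LF_nonneg[OF R(1)] K \<gamma>(1) Lf_nonneg
    by (intro mult_nonneg_nonneg add_nonneg_nonneg) auto
  \<comment> \<open>The 1 serves \<open>R\<close> and \<open>C\<close>; the second term keeps growth
    at rate \<open>B\<close> from \<open>M0\<close> below \<open>M\<close>; the third gives the
    contraction factor. Added ones keep the denominators positive.\<close>
  define r where "r = min 1 (min ((M - M0) / (B + 1)) (1 / (2 * (C + 1))))"
  have r: "0 < r" "r \<le> 1" "r \<le> (M - M0) / (B + 1)" "r \<le> 1 / (2 * (C + 1))"
    using assms(6) B(1) \<open>0 \<le> C\<close> by (auto simp: r_def)
  have "r * (B + 1) \<le> M - M0" using r(3) B(1) by (simp add: pos_le_divide_eq)
  then have rB: "M0 + r * B \<le> M" using r(1) by (simp add: algebra_simps)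
  have "r * (2 * (C + 1)) \<le> 1" using r(4) \<open>0 \<le> C\<close> by (simp add: pos_le_divide_eq)
  then have rC: "r * C \<le> 1 / 2" using r(1) by (simp add: algebra_simps)
  have small: "r * (LF R * (2 + (1 + K) * (r * Lf / \<gamma>))) \<le> 1 / 2"
  proof -
    have "r * Lf / \<gamma> \<le> Lf / \<gamma>"
      using r(2) Lf_nonneg \<gamma>(1) by (intro divide_right_mono mult_left_le_one_le) (use r(1) in auto)
    then have "LF R * (2 + (1 + K) * (r * Lf / \<gamma>)) \<le> C"
      unfolding C_def using LF_nonneg[OF R(1)] K(1) by (intro mult_left_mono add_left_mono) auto
    then show ?thesis using rC r(1) by (meson mult_left_mono less_imp_le order_trans)
  qed
  show ?thesis
  proof (intro exI[of _ r] conjI r(1) allI impI)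
    fix \<phi> \<tau>0
    assume *: "in_Lip_alpha \<Omega> \<alpha> \<phi> \<and> continuous_on \<Omega> \<tau>0 \<and> (\<forall>x\<in>\<Omega>. 0 \<le> \<tau>0 x) \<and>
           Lip_alpha_norm \<Omega> \<alpha> \<phi> + supn \<Omega> \<tau>0 \<le> M0"
    then have \<phi>: "in_Lip_alpha \<Omega> \<alpha> \<phi>" and \<tau>0_cont: "continuous_on \<Omega> \<tau>0"
      and \<tau>0_nonneg: "\<And>x. x \<in> \<Omega> \<Longrightarrow> 0 \<le> \<tau>0 x" by auto
    have \<phi>_cont: "continuous_on ({..0} \<times> \<Omega>) (\<lambda>(t, x). \<phi> t x)"
      using \<phi> cont_into_C_iff[OF assms(1)] by (auto simp: in_Lip_alpha_def)
    have norm: "Lip_alpha_norm \<Omega> \<alpha> \<phi> \<le> M0"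
      using * supn_nonneg[OF assms(1) \<tau>0_cont] by linarith
    note weighted = Lip_alpha_bounds[OF assms(1) \<phi>]
    note unweighted = Lip_alpha_bounds_unweighted[OF assms(1,2) \<phi> norm, where m = M0]
    have \<phi>_lip: "\<bar>\<phi> s x - \<phi> t x\<bar> \<le> K * \<bar>s - t\<bar>"
      if "s \<in> {-M0..0}" "t \<in> {-M0..0}" "x \<in> \<Omega>" for s t x
    proof -
      have "\<bar>\<phi> s x - \<phi> t x\<bar> \<le> K0 * \<bar>s - t\<bar>" unfolding K0_def by (rule unweighted(2)[OF that])
      also have "\<dots> \<le> K * \<bar>s - t\<bar>" using K(2) by (intro mult_right_mono) auto
      finally show ?thesis .
    qed
    \<comment> \<open>At time 0 the weight is 1, so the initial value obeys the bound
      \<open>M0\<close> without the exponential factor and leaves the room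
      \<open>M - M0\<close>.\<close>
    have \<phi>0: "\<bar>\<phi> 0 x\<bar> \<le> M0" if "x \<in> \<Omega>" for x
      using weighted(1)[OF norm, of 0 x] that by (simp add: wgt_def)
    have \<tau>0_le: "\<tau>0 x \<le> M0" if "x \<in> \<Omega>" for x
    proof -
      \<comment> \<open>The norm is itself an admissible \<open>N\<close>, and it dominates an
        absolute value at the point \<open>x\<close>.\<close>
      have "0 \<le> Lip_alpha_norm \<Omega> \<alpha> \<phi>" using weighted(1)[OF order_refl, of 0 x] that by linarith
      then show ?thesis using * abs_le_supn[OF assms(1) \<tau>0_cont that] by linarith
    qed
    have \<phi>_bound: "\<bar>\<phi> t x\<bar> \<le> R" if "t \<in> {-M0..0}" "x \<in> \<Omega>" for t x
      using unweighted(1)[OF that] R(3) by linarith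
    have "\<exists>A \<tau>. is_solution \<Omega> F f \<phi> \<tau>0 r A \<tau> \<and> (\<forall>t\<in>{0..r}. \<forall>x\<in>\<Omega>. \<bar>A t x\<bar> \<le> M)"
      by (rule solution_exists[OF _ _ R(1) K(1) \<gamma>(1) \<phi>_cont \<phi>_bound \<phi>_lip \<phi>0 \<tau>0_cont
            \<tau>0_nonneg \<tau>0_le B(2) \<gamma>(2) B(1) K(3) R(2) rB _ small])
        (use r(1,2) R(4) assms(5) in auto)
    then obtain A \<tau> where A: "is_solution \<Omega> F f \<phi> \<tau>0 r A \<tau>"
      "\<And>t x. t \<in> {0..r} \<Longrightarrow> x \<in> \<Omega> \<Longrightarrow> \<bar>A t x\<bar> \<le> M" by blast
    moreover have "supn \<Omega> (A t) \<le> M" if "t \<in> {0..r}" for t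
      using A(2)[OF that] assms(5,6) by (intro supn_least) auto
    ultimately show "\<exists>A \<tau>. is_solution \<Omega> F f \<phi> \<tau>0 r A \<tau> \<and> (\<forall>t\<in>{0..r}. supn \<Omega> (A t) \<le> M)"
      by blast
    fix A \<tau> A' \<tau>'
    assume sol: "is_solution \<Omega> F f \<phi> \<tau>0 r A \<tau> \<and> is_solution \<Omega> F f \<phi> \<tau>0 r A' \<tau>'"
    have "0 \<le> M0" "0 \<le> r" using assms(5) r(1) by auto
    note unique = solution_unique[OF conjunct1[OF sol] conjunct2[OF sol] this \<tau>0_nonneg \<tau>0_le \<phi>_lip]
    show "\<forall>x\<in>\<Omega>. A t x = A' t x" if "t \<le> r" for t by (intro ballI unique(1) that)
    show "\<forall>t\<in>{0..r}. \<forall>x\<in>\<Omega>. \<tau> t x = \<tau>' t x" by (intro ballI unique(2))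
  qed
qed

end
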